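(* Let $k\ge2$ and let $\nabla$ be a totally geodesic paraconformal connection on the solution space $M_F$ associated to an ODE $x^{(k+1)}=F(t,x,x',\ldots,x^{(k)})$ with vanishing Wünschmann invariants. Then $Ric(\nabla)(v,v)=0$ for every null vector $v$ of the canonical paraconformal structure on $M_F$; that is, the symmetric part of the Ricci tensor of $\nabla$ is a section of the bundle of symmetric 2-tensors annihilating the field of null cones of the paraconformal structure.
   Context: On $J^k(\mathbb{R},\mathbb{R})$ with standard coordinates $t,x_0,\ldots,x_k$, $\partial_i=\partial/\partial x_i$, let $X_F=\partial_t+x_1\partial_0+\cdots+x_k\partial_{k-1}+F\partial_k$; $M_F=J^k(\mathbb{R},\mathbb{R})/X_F$ is the (local) solution space with projection $\pi$. Write $\mathrm{ad}_XY=[X,Y]$, $\mathrm{ad}_X^{i+1}Y=[X,\mathrm{ad}_X^iY]$. There always exist (locally) nowhere vanishing functions $f,g$ on $J^k(\mathbb{R},\mathbb{R})$ with $\mathrm{ad}_{fX_F}^{k+1}g\partial_k=\sum_{i=0}^{k-2}L_i\,\mathrm{ad}_{fX_F}^ig\partial_k\mod X_F$; the Wünschmann invariants vanish if and only if all $L_i=0$. In this case the lines $\mathbb{R}\pi_*\partial_k$ along the fibre of $\pi$ over $y\in M_F$ lie on a rational normal curve of degree $k$ in $P(T_yM_F)$; the cone $C(y)\subset T_yM_F$ over this curve is the null cone, its elements are the null vectors, and $y\mapsto C(y)$ is the canonical paraconformal structure. Locally $C$ consists of multiples of $V(s)=V_0+sV_1+\cdots+s^kV_k$ (including $s=\infty$)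 with $V_0,\ldots,V_k$ a frame. A connection $\nabla$ on $M_F$ (possibly with torsion) is paraconformal if $\nabla_YV(s)\in\mathrm{span}\{V(s),\frac{d}{ds}V(s)\}$ for all $s$ and all vector fields $Y$. It is totally geodesic if the projections to $M_F$ of the integral manifolds of $\mathcal{D}_k=\mathrm{span}\{\partial_k,\ldots,\partial_1\}$ are totally geodesic submanifolds with respect to $\nabla$. The Ricci tensor is $Ric(\nabla)(Y,Z)=\mathrm{tr}\left(X\mapsto R(\nabla)(X,Y)Z\right)$. *)

theory Defs
  imports "HOL-Analysis.Analysis"
begin

section \<open>Smooth maps, vector fields, submanifolds\<close>

text \<open>Only used for open \<open>S\<close> in a finite-dimensional space, where continuity of all iterated
  directional derivatives is the usual notion of being of class $C^n$.\<close>

primrec Cn_on :: "nat \<Rightarrow> 'a::real_normed_vector set \<Rightarrow> ('a \<Rightarrow> 'b::real_normed_vector) \<Rightarrow> bool" where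
  "Cn_on 0 S f \<longleftrightarrow> continuous_on S f"
| "Cn_on (Suc n) S f \<longleftrightarrow> (\<forall>x\<in>S. f differentiable (at x)) \<and>
     (\<forall>v. Cn_on n S (\<lambda>x. frechet_derivative f (at x) v))"

definition smooth_on :: "'a::real_normed_vector set \<Rightarrow> ('a \<Rightarrow> 'b::real_normed_vector) \<Rightarrow> bool" where
  "smooth_on S f \<longleftrightarrow> (\<forall>n. Cn_on n S f)"

definition lie_bracket :: "('a::real_normed_vector \<Rightarrow> 'a) \<Rightarrow> ('a \<Rightarrow> 'a) \<Rightarrow> 'a \<Rightarrow> 'a" where
  "lie_bracket X Y p = frechet_derivative Y (at p) (X p) - frechet_derivative X (at p) (Y p)"

definition embedded_submanifold :: "nat \<Rightarrow> 'a::euclidean_space set \<Rightarrow> bool" where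
  "embedded_submanifold d N \<longleftrightarrow> (\<forall>p\<in>N. \<exists>W \<phi> \<psi> S.
     open W \<and> p \<in> W \<and> open (\<phi> ` W) \<and> smooth_on W \<phi> \<and> smooth_on (\<phi> ` W) \<psi> \<and>
     (\<forall>x\<in>W. \<psi> (\<phi> x) = x) \<and> subspace (S :: 'a set) \<and> dim S = d \<and>
     \<phi> ` (N \<inter> W) = S \<inter> \<phi> ` W)"

definition tangent_space :: "'a::real_normed_vector set \<Rightarrow> 'a \<Rightarrow> 'a set" where
  "tangent_space N y = {v. \<exists>e>0. \<exists>c. smooth_on {-e<..<e::real} c \<and> c ` {-e<..<e} \<subseteq> N \<and> c 0 = y \<and>
     (c has_vector_derivative v) (at 0)}"

definition integral_manifold :: "nat \<Rightarrow> ('a::euclidean_space \<Rightarrow> 'a set) \<Rightarrow> 'a set \<Rightarrow> bool" where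
  "integral_manifold d D N \<longleftrightarrow> connected N \<and> embedded_submanifold d N \<and>
     (\<forall>p\<in>N. tangent_space N p = D p)"


section \<open>The jet space and the solution space\<close>

text \<open>A point of $J^k(\mathbb{R},\mathbb{R})$ is a pair \<open>(t, x)\<close>, where \<open>ix\<close> is a bijection from
  \<open>{..k}\<close> to the index type and the coordinate $x_i$ is \<open>x $ ix i\<close>.\<close>

type_synonym 'n jet = "real \<times> (real ^ 'n)"

definition jet_t :: "'n::finite jet" where
  "jet_t = (1, 0)"

definition jet_partial :: "(nat \<Rightarrow> 'n::finite) \<Rightarrow> nat \<Rightarrow> 'n jet" where
  "jet_partial ix i = (0, axis (ix i) 1)"

definition total_derivative ::
    "(nat \<Rightarrow> 'n::finite) \<Rightarrow> nat \<Rightarrow> ('n jet \<Rightarrow> real) \<Rightarrow> 'n jet \<Rightarrow> 'n jet" where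
  "total_derivative ix k F p =
     jet_t + (\<Sum>i<k. (snd p $ ix (Suc i)) *\<^sub>R jet_partial ix i) + F p *\<^sub>R jet_partial ix k"

definition same_integral_curve :: "'a::real_normed_vector set \<Rightarrow> ('a \<Rightarrow> 'a) \<Rightarrow> 'a \<Rightarrow> 'a \<Rightarrow> bool" where
  "same_integral_curve U X p q \<longleftrightarrow> (\<exists>(I::real set) c. is_interval I \<and> c ` I \<subseteq> U \<and>
     (\<forall>\<tau>\<in>I. (c has_vector_derivative X (c \<tau>)) (at \<tau> within I)) \<and> p \<in> c ` I \<and> q \<in> c ` I)"

text \<open>\<open>\<pi> : U \<rightarrow> M\<close> realises the quotient of an open set \<open>U\<close> of jets by the integral curves of $X_F$,
  with \<open>M\<close> an open set in a coordinate space of dimension $k+1$. The choice of \<open>\<pi>\<close> is the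
  choice of a coordinate system on the solution space.\<close>

definition solution_space ::
    "(nat \<Rightarrow> 'n::finite) \<Rightarrow> nat \<Rightarrow> ('n jet \<Rightarrow> real) \<Rightarrow> ('n jet) set \<Rightarrow>
     ('n jet \<Rightarrow> real ^ 'n) \<Rightarrow> (real ^ 'n) set \<Rightarrow> bool" where
  "solution_space ix k F U \<pi> M \<longleftrightarrow>
     bij_betw ix {..k} UNIV \<and> open U \<and> smooth_on U F \<and> open M \<and> \<pi> ` U = M \<and> smooth_on U \<pi> \<and>
     (\<forall>p\<in>U. range (frechet_derivative \<pi> (at p)) = UNIV \<and>
             frechet_derivative \<pi> (at p) (total_derivative ix k F p) = 0) \<and>
     (\<forall>p\<in>U. \<forall>q\<in>U. \<pi> p = \<pi> q \<longleftrightarrow> same_integral_curve U (total_derivative ix k F) p q)"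

definition wuenschmann_normal_form ::
    "(nat \<Rightarrow> 'n::finite) \<Rightarrow> nat \<Rightarrow> ('n jet \<Rightarrow> real) \<Rightarrow> ('n jet) set \<Rightarrow>
     ('n jet \<Rightarrow> real) \<Rightarrow> ('n jet \<Rightarrow> real) \<Rightarrow>
     (nat \<Rightarrow> 'n jet \<Rightarrow> real) \<Rightarrow> bool" where
  "wuenschmann_normal_form ix k F W f g L \<longleftrightarrow>
     smooth_on W f \<and> smooth_on W g \<and> (\<forall>i\<le>k - 2. smooth_on W (L i)) \<and>
     (\<forall>p\<in>W. f p \<noteq> 0 \<and> g p \<noteq> 0) \<and>
     (let X = total_derivative ix k F;
          ad = (\<lambda>i. (lie_bracket (\<lambda>p. f p *\<^sub>R X p) ^^ i) (\<lambda>p. g p *\<^sub>R jet_partial ix k))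
      in \<forall>p\<in>W. \<exists>c. ad (k + 1) p = (\<Sum>i\<le>k - 2. L i p *\<^sub>R ad i p) + c *\<^sub>R X p)"

definition wuenschmann_invariants_vanish ::
    "(nat \<Rightarrow> 'n::finite) \<Rightarrow> nat \<Rightarrow> ('n jet \<Rightarrow> real) \<Rightarrow> ('n jet) set \<Rightarrow> bool" where
  "wuenschmann_invariants_vanish ix k F U \<longleftrightarrow>
     (\<forall>p\<in>U. \<exists>W f g L. open W \<and> p \<in> W \<and> W \<subseteq> U \<and> wuenschmann_normal_form ix k F W f g L \<and>
        (\<forall>i\<le>k - 2. \<forall>q\<in>W. L i q = 0))"


section \<open>The canonical paraconformal structure\<close>

definition is_basis :: "nat \<Rightarrow> (nat \<Rightarrow> 'a::euclidean_space) \<Rightarrow> bool" where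
  "is_basis k b \<longleftrightarrow> inj_on b {..k} \<and> independent (b ` {..k}) \<and> span (b ` {..k}) = UNIV"

definition rnc_point :: "nat \<Rightarrow> (nat \<Rightarrow> 'a::real_vector) \<Rightarrow> real \<Rightarrow> 'a" where
  "rnc_point k b s = (\<Sum>i\<le>k. s ^ i *\<^sub>R b i)"

text \<open>The second set is the line of the point $s = \infty$.\<close>

definition rnc_cone :: "nat \<Rightarrow> (nat \<Rightarrow> 'a::real_vector) \<Rightarrow> 'a set" where
  "rnc_cone k b = {c *\<^sub>R rnc_point k b s | c s. True} \<union> {c *\<^sub>R b k | c. True}"

text \<open>A rational normal curve of degree $k$ is determined by $k+3$ of its points, and the lines
  spanned by $\pi_*\partial_k$ along a fibre are infinitely many. Hence the cone \<open>C\<close> below is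
  unique, and the set of null vectors is that single cone.\<close>

definition null_cone ::
    "(nat \<Rightarrow> 'n::finite) \<Rightarrow> nat \<Rightarrow> ('n jet) set \<Rightarrow> ('n jet \<Rightarrow> real ^ 'n) \<Rightarrow>
     real ^ 'n \<Rightarrow> (real ^ 'n) set" where
  "null_cone ix k U \<pi> y = {v. \<exists>C. (\<exists>b. is_basis k b \<and> C = rnc_cone k b) \<and>
     (\<forall>p\<in>U. \<pi> p = y \<longrightarrow> frechet_derivative \<pi> (at p) (jet_partial ix k) \<in> C) \<and> v \<in> C}"

definition paraconformal_frame ::
    "(nat \<Rightarrow> 'n::finite) \<Rightarrow> nat \<Rightarrow> ('n jet) set \<Rightarrow> ('n jet \<Rightarrow> real ^ 'n) \<Rightarrow>
     (real ^ 'n) set \<Rightarrow> (nat \<Rightarrow> real ^ 'n \<Rightarrow> real ^ 'n) \<Rightarrow> bool" where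
  "paraconformal_frame ix k U \<pi> W V \<longleftrightarrow> (\<forall>i\<le>k. smooth_on W (V i)) \<and>
     (\<forall>z\<in>W. is_basis k (\<lambda>i. V i z) \<and> null_cone ix k U \<pi> z = rnc_cone k (\<lambda>i. V i z))"


section \<open>Connections\<close>

text \<open>A connection on an open subset of a coordinate space is given by its Christoffel symbols:
  \<open>\<Gamma> y u v\<close> is $\nabla_u v$ at \<open>y\<close> for constant fields. No symmetry is
  required, so torsion is allowed.\<close>

definition is_connection :: "'a::euclidean_space set \<Rightarrow> ('a \<Rightarrow> 'a \<Rightarrow> 'a \<Rightarrow> 'a) \<Rightarrow> bool" where
  "is_connection M \<Gamma> \<longleftrightarrow> (\<forall>y\<in>M. bilinear (\<Gamma> y)) \<and> (\<forall>u v. smooth_on M (\<lambda>y. \<Gamma> y u v))"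

definition cov_deriv ::
    "('a::real_normed_vector \<Rightarrow> 'a \<Rightarrow> 'a \<Rightarrow> 'a) \<Rightarrow> ('a \<Rightarrow> 'a) \<Rightarrow> ('a \<Rightarrow> 'a) \<Rightarrow> 'a \<Rightarrow> 'a" where
  "cov_deriv \<Gamma> Y Z y = frechet_derivative Z (at y) (Y y) + \<Gamma> y (Y y) (Z y)"

definition curvature ::
    "('a::real_normed_vector \<Rightarrow> 'a \<Rightarrow> 'a \<Rightarrow> 'a) \<Rightarrow> ('a \<Rightarrow> 'a) \<Rightarrow> ('a \<Rightarrow> 'a) \<Rightarrow> ('a \<Rightarrow> 'a) \<Rightarrow> 'a \<Rightarrow> 'a" where
  "curvature \<Gamma> X Y Z y = cov_deriv \<Gamma> X (cov_deriv \<Gamma> Y Z) y - cov_deriv \<Gamma> Y (cov_deriv \<Gamma> X Z) y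
     - cov_deriv \<Gamma> (lie_bracket X Y) Z y"

text \<open>The curvature is tensorial, so tangent vectors at \<open>y\<close> may be extended to constant fields.\<close>

definition ricci :: "(real ^ 'n \<Rightarrow> real ^ 'n \<Rightarrow> real ^ 'n \<Rightarrow> real ^ 'n) \<Rightarrow> real ^ 'n \<Rightarrow> real ^ 'n \<Rightarrow> real ^ 'n \<Rightarrow> real" where
  "ricci \<Gamma> y v w = trace (matrix (\<lambda>u. curvature \<Gamma> (\<lambda>_. u) (\<lambda>_. v) (\<lambda>_. w) y))"

definition ricci_sym :: "(real ^ 'n \<Rightarrow> real ^ 'n \<Rightarrow> real ^ 'n \<Rightarrow> real ^ 'n) \<Rightarrow> real ^ 'n \<Rightarrow> real ^ 'n \<Rightarrow> real ^ 'n \<Rightarrow> real" where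
  "ricci_sym \<Gamma> y v w = (ricci \<Gamma> y v w + ricci \<Gamma> y w v) / 2"

definition geodesic ::
    "'a::real_normed_vector set \<Rightarrow> ('a \<Rightarrow> 'a \<Rightarrow> 'a \<Rightarrow> 'a) \<Rightarrow> real \<Rightarrow> (real \<Rightarrow> 'a) \<Rightarrow> (real \<Rightarrow> 'a) \<Rightarrow> bool" where
  "geodesic M \<Gamma> e \<gamma> \<gamma>' \<longleftrightarrow> (\<forall>\<tau>\<in>{-e<..<e}. \<gamma> \<tau> \<in> M \<and> (\<gamma> has_vector_derivative \<gamma>' \<tau>) (at \<tau>) \<and>
     (\<gamma>' has_vector_derivative - \<Gamma> (\<gamma> \<tau>) (\<gamma>' \<tau>) (\<gamma>' \<tau>)) (at \<tau>))"

text \<open>For connections with torsion this is weaker than requiring $\nabla_YZ$ to be tangent to \<open>N\<close>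
  for all \<open>Y\<close>, \<open>Z\<close> tangent to \<open>N\<close>.\<close>

definition totally_geodesic ::
    "'a::real_normed_vector set \<Rightarrow> ('a \<Rightarrow> 'a \<Rightarrow> 'a \<Rightarrow> 'a) \<Rightarrow> 'a set \<Rightarrow> bool" where
  "totally_geodesic M \<Gamma> N \<longleftrightarrow> (\<forall>e>0. \<forall>\<gamma> \<gamma>'. geodesic M \<Gamma> e \<gamma> \<gamma>' \<and> \<gamma> 0 \<in> N \<and>
     \<gamma>' 0 \<in> tangent_space N (\<gamma> 0) \<longrightarrow> (\<forall>\<^sub>F \<tau> in nhds 0. \<gamma> \<tau> \<in> N))"

definition paraconformal_connection ::
    "(nat \<Rightarrow> 'n::finite) \<Rightarrow> nat \<Rightarrow> ('n jet) set \<Rightarrow> ('n jet \<Rightarrow> real ^ 'n) \<Rightarrow>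
     (real ^ 'n) set \<Rightarrow> (real ^ 'n \<Rightarrow> real ^ 'n \<Rightarrow> real ^ 'n \<Rightarrow> real ^ 'n) \<Rightarrow> bool" where
  "paraconformal_connection ix k U \<pi> M \<Gamma> \<longleftrightarrow>
     (\<forall>y\<in>M. \<exists>W V. open W \<and> y \<in> W \<and> W \<subseteq> M \<and> paraconformal_frame ix k U \<pi> W V \<and>
        (\<forall>Y s. smooth_on W Y \<longrightarrow>
           (\<forall>z\<in>W. cov_deriv \<Gamma> Y (\<lambda>z. rnc_point k (\<lambda>i. V i z) s) z \<in>
              span {rnc_point k (\<lambda>i. V i z) s,
                    vector_derivative (rnc_point k (\<lambda>i. V i z)) (at s)})))"

definition totally_geodesic_connection ::
    "(nat \<Rightarrow> 'n::finite) \<Rightarrow> nat \<Rightarrow> ('n jet) set \<Rightarrow> ('n jet \<Rightarrow> real ^ 'n) \<Rightarrow>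
     (real ^ 'n) set \<Rightarrow> (real ^ 'n \<Rightarrow> real ^ 'n \<Rightarrow> real ^ 'n \<Rightarrow> real ^ 'n) \<Rightarrow> bool" where
  "totally_geodesic_connection ix k U \<pi> M \<Gamma> \<longleftrightarrow>
     (\<forall>N\<subseteq>U. integral_manifold k (\<lambda>p. span (jet_partial ix ` {1..k})) N \<longrightarrow>
        totally_geodesic M \<Gamma> (\<pi> ` N))"

definition annihilating_section ::
    "'a::euclidean_space set \<Rightarrow> ('a \<Rightarrow> 'a set) \<Rightarrow> ('a \<Rightarrow> 'a \<Rightarrow> 'a \<Rightarrow> real) \<Rightarrow> bool" where
  "annihilating_section M C h \<longleftrightarrow> (\<forall>v w. smooth_on M (\<lambda>y. h y v w)) \<and>
     (\<forall>y\<in>M. bilinear (h y) \<and> (\<forall>v w. h y v w = h y w v) \<and> (\<forall>v\<in>C y. h y v v = 0))"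

end

(*
  Write E_i = D pi (d_i). Lifting the connection to the jet space along pi gives an operator nabla on
  (real^'n)-valued functions of jets with nabla_u nabla_v - nabla_v nabla_u = R(D pi u, D pi v), and
  the total derivative X, on which D pi vanishes, satisfies X E_i = - E_{i-1} - (d_i F) E_k. Since
  E_k spans a null line, paraconformality gives nabla_v E_k = alpha_v E_k + beta_v E_{k-1}.
  Commuting nabla_v with X propagates this to nabla_v E_i = beta_v E_{i-1} modulo E_i, ..., E_k.
  Geodesics staying in the projected slices force the symmetric part of the E_0-coefficient of
  nabla_{d_i} E_j (i, j >= 1) to vanish, so beta vanishes on the d_j with j >= 1: the null line of
  E_k is parallel along the slices. Hence R(E_i, E_k) E_k is a multiple of E_k for i >= 1 and has no
  E_0-component for i = 0, and the trace Ric(E_k, E_k) is zero. A fibre of pi meets infinitely many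
  lines of the cone and Ric(V(s), V(s)) is polynomial in s, so Ric vanishes on the whole cone.
*)

theory Submission
  imports Defs
begin

section \<open>Calculus of smooth maps\<close>

text \<open>The null line spanned by E_k is not attached to a point of M: over y it moves along the
  curve as the jet runs through the fibre. Hence the frame of the E_i lives on jets, and
  differentiating along the fibre, where the connection contributes nothing, turns one algebraic
  condition into a chain of them. The span of V(s) and V'(s) becomes that of E_k and E_{k-1},
  because the total derivative of E_k lies in it and has E_{k-1}-coefficient -1. Torsion is the
  obstacle: geodesics see only the symmetric part of the second fundamental form of a projected
  slice. The shift along X supplies the rest: the E_0-coefficient of nabla_v E_i vanishes for i >= 2
  and every v, so pairing d_j with d_1 isolates that of nabla_{d_j} E_1, which is beta at d_j. Total
  geodesy constrains only geodesics that are given, so they must be produced by an existence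
  theorem; the same theorem gives curves in the fibres of pi. The parameter s = infinity is avoided
  by restricting to jets whose null line is a finite point, and is recovered at the end from the
  leading coefficient of Ric(V(s), V(s)).\<close>

abbreviation D :: "('a::real_normed_vector \<Rightarrow> 'b::real_normed_vector) \<Rightarrow> 'a \<Rightarrow> 'a \<Rightarrow> 'b" where
  "D f p \<equiv> frechet_derivative f (at p)"

lemma D_eqI: "(f has_derivative f') (at p) \<Longrightarrow> D f p v = f' v"
  by (metis frechet_derivative_at)

lemma has_derivative_D: "f differentiable at p \<Longrightarrow> (f has_derivative D f p) (at p)"
  by (simp add: frechet_derivative_works)

lemma bounded_linear_D: "f differentiable at p \<Longrightarrow> bounded_linear (D f p)"
  using has_derivative_D has_derivative_bounded_linear by blast

lemma linear_D: "f differentiable at p \<Longrightarrow> linear (D f p)"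
  using bounded_linear_D bounded_linear.linear by blast

lemma D_cong:
  assumes "open S" "p \<in> S" "\<And>x. x \<in> S \<Longrightarrow> f x = g x" "f differentiable at p"
  shows "D g p = D f p"
proof -
  have "(g has_derivative D f p) (at p)"
    using has_derivative_transform_within_open[OF has_derivative_D[OF assms(4)] assms(1,2)] assms(3)
    by metis
  then show ?thesis
    by (metis frechet_derivative_at)
qed

lemma differentiable_cong_open:
  assumes "open S" "p \<in> S" "\<And>x. x \<in> S \<Longrightarrow> f x = g x" "f differentiable at p"
  shows "g differentiable at p"
  using has_derivative_transform_within_open[OF has_derivative_D[OF assms(4)] assms(1,2)] assms(3)
  by (metis differentiableI)

lemma Cn_on_cong:
  assumes "open S" "Cn_on n S f" "\<And>x. x \<in> S \<Longrightarrow> f x = g x"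
  shows "Cn_on n S g"
  using assms(2,3)
proof (induction n arbitrary: f g)
  case 0
  then show ?case
    by (metis Cn_on.simps(1) continuous_on_cong)
next
  case (Suc n)
  have "Cn_on n S (\<lambda>x. D g x v)" for v
    by (rule Suc.IH[of "\<lambda>x. D f x v"])
      (use Suc.prems D_cong[OF assms(1), of _ f g] in \<open>auto\<close>)
  then show ?case
    using Suc.prems differentiable_cong_open[OF assms(1), of _ f g] by auto
qed

lemma Cn_on_SucD: "Cn_on (Suc n) S f \<Longrightarrow> Cn_on n S f"
proof (induction n arbitrary: f)
  case 0
  then show ?case
    by (auto intro!: continuous_at_imp_continuous_on differentiable_imp_continuous_within)
qed auto

lemma Cn_on_subset: "Cn_on n S f \<Longrightarrow> T \<subseteq> S \<Longrightarrow> Cn_on n T f"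
  by (induction n arbitrary: f) (auto intro: continuous_on_subset)

lemma Cn_on_const: "Cn_on n S (\<lambda>x. c)"
  by (induction n arbitrary: c) auto

lemma Cn_on_bounded_linear:
  assumes "open S" "bounded_linear L" "Cn_on n S f"
  shows "Cn_on n S (\<lambda>x. L (f x))"
  using assms(3)
proof (induction n arbitrary: f)
  case 0
  then show ?case
    using bounded_linear.continuous_on[OF assms(2)] by auto
next
  case (Suc n)
  have hd: "((\<lambda>x. L (f x)) has_derivative (\<lambda>v. L (D f x v))) (at x)" if "x \<in> S" for x
    using bounded_linear.has_derivative[OF assms(2) has_derivative_D] Suc.prems that by auto
  have "Cn_on n S (\<lambda>x. D (\<lambda>x. L (f x)) x v)" for v
    by (rule Cn_on_cong[OF assms(1), of _ "\<lambda>x. L (D f x v)"])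
      (use Suc D_eqI[OF hd] in auto)
  then show ?case
    by (auto intro: differentiableI[OF hd])
qed

lemma Cn_on_add:
  assumes "open S" "Cn_on n S f" "Cn_on n S g"
  shows "Cn_on n S (\<lambda>x. f x + g x)"
  using assms(2,3)
proof (induction n arbitrary: f g)
  case 0
  then show ?case
    by (auto intro: continuous_intros)
next
  case (Suc n)
  have hd: "((\<lambda>x. f x + g x) has_derivative (\<lambda>v. D f x v + D g x v)) (at x)" if "x \<in> S" for x
    using Suc.prems that by (auto intro!: has_derivative_add has_derivative_D)
  have "Cn_on n S (\<lambda>x. D (\<lambda>x. f x + g x) x v)" for v
    by (rule Cn_on_cong[OF assms(1), of _ "\<lambda>x. D f x v + D g x v"])
      (use Suc D_eqI[OF hd] in auto)
  then show ?case
    by (auto intro: differentiableI[OF hd])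
qed

lemma Cn_on_bilinear:
  assumes "open S" "bounded_bilinear b" "Cn_on n S f" "Cn_on n S g"
  shows "Cn_on n S (\<lambda>x. b (f x) (g x))"
  using assms(3,4)
proof (induction n arbitrary: f g)
  case 0
  then show ?case
    using bounded_bilinear.continuous_on[OF assms(2)] by auto
next
  case (Suc n)
  have hd: "((\<lambda>x. b (f x) (g x)) has_derivative (\<lambda>v. b (f x) (D g x v) + b (D f x v) (g x))) (at x)"
    if "x \<in> S" for x
    by (rule bounded_bilinear.FDERIV[OF assms(2) has_derivative_D has_derivative_D])
      (use Suc.prems that in auto)
  have "Cn_on n S (\<lambda>x. D (\<lambda>x. b (f x) (g x)) x v)" for v
    by (rule Cn_on_cong[OF assms(1), of _ "\<lambda>x. b (f x) (D g x v) + b (D f x v) (g x)"])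
      (use Suc Cn_on_SucD[OF Suc.prems(1)] Cn_on_SucD[OF Suc.prems(2)] D_eqI[OF hd] in
        \<open>auto intro!: Cn_on_add[OF assms(1)]\<close>)
  then show ?case
    by (auto intro: differentiableI[OF hd])
qed

lemma Cn_on_sum:
  assumes "open S" "\<And>i. i \<in> I \<Longrightarrow> Cn_on n S (f i)"
  shows "Cn_on n S (\<lambda>x. \<Sum>i\<in>I. f i x)"
  using assms(2)
  by (induction I rule: infinite_finite_induct) (auto intro!: Cn_on_const Cn_on_add[OF assms(1)])

lemma linear_expand:
  fixes L :: "'a::euclidean_space \<Rightarrow> 'b::real_vector"
  assumes "linear L"
  shows "L v = (\<Sum>b\<in>Basis. (v \<bullet> b) *\<^sub>R L b)"
proof -
  have "L v = L (\<Sum>b\<in>Basis. (v \<bullet> b) *\<^sub>R b)"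
    by (simp add: euclidean_representation)
  then show ?thesis
    using assms by (simp add: linear_sum linear_scale)
qed

text \<open>\<open>Cn_on\<close> differentiates only in fixed directions, whereas the chain rule
  gives \<open>D f (g x)\<close> in the moving direction \<open>D g x v\<close>. Expanding that
  direction in \<open>Basis\<close> leaves finitely many functions \<open>D f (g x) b\<close> with
  \<open>b\<close> fixed, to which the induction hypothesis applies.\<close>

lemma Cn_on_compose:
  fixes f :: "'b::euclidean_space \<Rightarrow> 'c::real_normed_vector"
  assumes "open S" "Cn_on n S g" "Cn_on n T f" "g ` S \<subseteq> T"
  shows "Cn_on n S (\<lambda>x. f (g x))"
  using assms(2,3)
proof (induction n arbitrary: f)
  case 0
  then show ?case
    using assms(4) continuous_on_compose2[of T f S g] by auto
next
  case (Suc n)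
  have hd: "((\<lambda>x. f (g x)) has_derivative (\<lambda>v. \<Sum>b\<in>Basis. (D g x v \<bullet> b) *\<^sub>R D f (g x) b)) (at x)"
    if "x \<in> S" for x
  proof -
    have "g x \<in> T"
      using assms(4) that by auto
    then have d: "f differentiable at (g x)" "g differentiable at x"
      using Suc.prems that by auto
    have "((\<lambda>x. f (g x)) has_derivative (\<lambda>v. D f (g x) (D g x v))) (at x)"
      using has_derivative_compose[OF has_derivative_D[OF d(2)] has_derivative_D[OF d(1)]] .
    moreover have "(\<lambda>v. D f (g x) (D g x v)) = (\<lambda>v. \<Sum>b\<in>Basis. (D g x v \<bullet> b) *\<^sub>R D f (g x) b)"
      by (intro ext linear_expand linear_D d(1))
    ultimately show ?thesis
      by (simp only:)
  qed
  have "Cn_on n S (\<lambda>x. (D g x v \<bullet> b) *\<^sub>R D f (g x) b)" for v b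
    using Suc.prems Suc.IH[of "\<lambda>y. D f y b"] Cn_on_SucD[OF Suc.prems(1)]
    by (auto intro!: Cn_on_bilinear[OF assms(1) bounded_bilinear_scaleR]
        Cn_on_bounded_linear[OF assms(1) bounded_linear_inner_left])
  then have "Cn_on n S (\<lambda>x. D (\<lambda>x. f (g x)) x v)" for v
    by (rule Cn_on_cong[OF assms(1) Cn_on_sum[OF assms(1)]])
      (use D_eqI[OF hd] in auto)
  then show ?case
    by (auto intro: differentiableI[OF hd])
qed

text \<open>The derivative contains \<open>inverse (f x)\<close> again, but only to the lower order
  that the induction has already settled.\<close>

lemma Cn_on_inverse:
  fixes f :: "'a::real_normed_vector \<Rightarrow> real"
  assumes "open S" "Cn_on n S f" "\<And>x. x \<in> S \<Longrightarrow> f x \<noteq> 0"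
  shows "Cn_on n S (\<lambda>x. inverse (f x))"
  using assms(2)
proof (induction n)
  case 0
  then show ?case
    using assms(3) by (auto intro!: continuous_intros)
next
  case (Suc n)
  have hd: "((\<lambda>x. inverse (f x)) has_derivative (\<lambda>v. - (inverse (f x) * D f x v * inverse (f x)))) (at x)"
    if "x \<in> S" for x
    by (rule Deriv.has_derivative_inverse[where f=f, OF assms(3)[OF that] has_derivative_D]) (use Suc.prems that in auto)
  have "Cn_on n S (\<lambda>x. - (inverse (f x) * D f x v * inverse (f x)))" for v
    using Suc Cn_on_SucD[OF Suc.prems]
    by (auto intro!: Cn_on_bounded_linear[OF assms(1) bounded_linear_minus[OF bounded_linear_ident]]
        Cn_on_bilinear[OF assms(1) bounded_bilinear_mult])
  then have "Cn_on n S (\<lambda>x. D (\<lambda>x. inverse (f x)) x v)" for v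
    by (rule Cn_on_cong[OF assms(1)]) (use D_eqI[OF hd] in auto)
  then show ?case
    by (auto intro: differentiableI[OF hd])
qed

section \<open>Closure properties of smooth maps\<close>

lemma smooth_on_differentiable: "smooth_on S f \<Longrightarrow> x \<in> S \<Longrightarrow> f differentiable at x"
  unfolding smooth_on_def by (metis Cn_on.simps(2))

lemma smooth_on_D: "smooth_on S f \<Longrightarrow> smooth_on S (\<lambda>x. D f x v)"
  unfolding smooth_on_def by (metis Cn_on.simps(2))

lemma smooth_on_continuous: "smooth_on S f \<Longrightarrow> continuous_on S f"
  unfolding smooth_on_def by (metis Cn_on.simps(1))

lemma smooth_on_cong: "open S \<Longrightarrow> smooth_on S f \<Longrightarrow> (\<And>x. x \<in> S \<Longrightarrow> f x = g x) \<Longrightarrow> smooth_on S g"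
  unfolding smooth_on_def using Cn_on_cong[of S _ f g] by auto

lemma smooth_on_subset: "smooth_on S f \<Longrightarrow> T \<subseteq> S \<Longrightarrow> smooth_on T f"
  unfolding smooth_on_def using Cn_on_subset[of _ S f T] by auto

lemma smooth_on_const: "smooth_on S (\<lambda>x. c)"
  unfolding smooth_on_def by (simp add: Cn_on_const)

lemma smooth_on_bounded_linear: "open S \<Longrightarrow> bounded_linear L \<Longrightarrow> smooth_on S f \<Longrightarrow> smooth_on S (\<lambda>x. L (f x))"
  unfolding smooth_on_def using Cn_on_bounded_linear[of S L _ f] by auto

lemma smooth_on_ident: "open S \<Longrightarrow> smooth_on S (\<lambda>x. x)"
  unfolding smooth_on_def
proof
  fix n
  assume S: "open S"
  show "Cn_on n S (\<lambda>x. x)"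
    by (cases n) (auto simp: Cn_on_const)
qed

lemma smooth_on_add: "open S \<Longrightarrow> smooth_on S f \<Longrightarrow> smooth_on S g \<Longrightarrow> smooth_on S (\<lambda>x. f x + g x)"
  unfolding smooth_on_def using Cn_on_add[of S _ f g] by auto

lemma smooth_on_minus: "open S \<Longrightarrow> smooth_on S f \<Longrightarrow> smooth_on S (\<lambda>x. - f x)"
  using smooth_on_bounded_linear[OF _ bounded_linear_minus[OF bounded_linear_ident], of S f] by auto

lemma smooth_on_diff: "open S \<Longrightarrow> smooth_on S f \<Longrightarrow> smooth_on S g \<Longrightarrow> smooth_on S (\<lambda>x. f x - g x)"
  using smooth_on_add[OF _ _ smooth_on_minus, of S f g] by simp

lemma smooth_on_bilinear:
  "open S \<Longrightarrow> bounded_bilinear b \<Longrightarrow> smooth_on S f \<Longrightarrow> smooth_on S g \<Longrightarrow> smooth_on S (\<lambda>x. b (f x) (g x))"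
  unfolding smooth_on_def using Cn_on_bilinear[of S b _ f g] by auto

lemmas smooth_on_scaleR = smooth_on_bilinear[OF _ bounded_bilinear_scaleR]

lemma smooth_on_mult:
  fixes f g :: "'a::real_normed_vector \<Rightarrow> real"
  shows "open S \<Longrightarrow> smooth_on S f \<Longrightarrow> smooth_on S g \<Longrightarrow> smooth_on S (\<lambda>x. f x * g x)"
  using smooth_on_bilinear[OF _ bounded_bilinear_mult, of S f g] by auto

lemma smooth_on_sum: "open S \<Longrightarrow> (\<And>i. i \<in> I \<Longrightarrow> smooth_on S (f i)) \<Longrightarrow> smooth_on S (\<lambda>x. \<Sum>i\<in>I. f i x)"
  unfolding smooth_on_def using Cn_on_sum[of S I _ f] by auto

lemma smooth_on_prod:
  fixes f :: "'i \<Rightarrow> 'a::real_normed_vector \<Rightarrow> real"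
  assumes "open S" "\<And>i. i \<in> I \<Longrightarrow> smooth_on S (f i)"
  shows "smooth_on S (\<lambda>x. \<Prod>i\<in>I. f i x)"
  using assms(2)
  by (induction I rule: infinite_finite_induct) (auto intro!: smooth_on_const smooth_on_mult[OF assms(1)])

lemma smooth_on_compose:
  fixes f :: "'b::euclidean_space \<Rightarrow> 'c::real_normed_vector"
  shows "open S \<Longrightarrow> smooth_on S g \<Longrightarrow> smooth_on T f \<Longrightarrow> g ` S \<subseteq> T \<Longrightarrow> smooth_on S (\<lambda>x. f (g x))"
  unfolding smooth_on_def using Cn_on_compose[of S _ g T f] by auto

lemma smooth_on_divide:
  fixes f g :: "'a::real_normed_vector \<Rightarrow> real"
  assumes "open S" "smooth_on S f" "smooth_on S g" "\<And>x. x \<in> S \<Longrightarrow> g x \<noteq> 0"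
  shows "smooth_on S (\<lambda>x. f x / g x)"
proof -
  have "smooth_on S (\<lambda>x. inverse (g x))"
    using assms(1,3,4) Cn_on_inverse[of S _ g] unfolding smooth_on_def by auto
  then show ?thesis
    unfolding divide_inverse using smooth_on_mult[OF assms(1,2)] by auto
qed

lemma smooth_on_vec_nth: "open S \<Longrightarrow> smooth_on S f \<Longrightarrow> smooth_on S (\<lambda>x. f x $ i)"
  using smooth_on_bounded_linear[OF _ bounded_linear_vec_nth, of S f i] by auto

lemma smooth_on_det:
  fixes A :: "'a::real_normed_vector \<Rightarrow> real^'n^'n"
  assumes "open S" "\<And>i j. smooth_on S (\<lambda>x. A x $ i $ j)"
  shows "smooth_on S (\<lambda>x. det (A x))"
  unfolding det_def
  by (intro smooth_on_sum[OF assms(1)] smooth_on_mult[OF assms(1)] smooth_on_const smooth_on_prod[OF assms(1)] assms(2))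

text \<open>The second difference of f over the parallelogram with sides hu and hv is symmetric in u
  and v. Two applications of the mean value theorem turn it into h^2 times either mixed derivative
  at a point within distance hN of p; continuity, as h tends to 0, identifies the two
  values.\<close>

lemma D_D_commute_real:
  fixes f :: "'a::real_normed_vector \<Rightarrow> real"
  assumes "open S" "p \<in> S" "Cn_on 2 S f"
  shows "D (\<lambda>x. D f x u) p v = D (\<lambda>x. D f x v) p u"
proof -
  have diff: "f differentiable at x" "(\<lambda>x. D f x w) differentiable at x" if "x \<in> S" for x w
    using assms(3) that by (auto simp: numeral_2_eq_2)
  have cont: "continuous_on S (\<lambda>x. D (\<lambda>x. D f x a) x b)" for a b
    using assms(3) by (auto simp: numeral_2_eq_2)
  obtain r where r: "r > 0" "ball p r \<subseteq> S"
    using assms(1,2) open_contains_ball by blast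
  \<comment> \<open>The summand 1 keeps \<open>N\<close> positive when u = v = 0, so that h < r / N
    is meaningful and keeps the parallelogram inside the ball.\<close>
  define N where "N = norm u + norm v + 1"
  have N: "N > 0" 
    unfolding N_def by (smt (verit) norm_ge_zero)
  have inS: "p + s *\<^sub>R a + t *\<^sub>R b \<in> S" and inB: "dist p (p + s *\<^sub>R a + t *\<^sub>R b) \<le> h * N"
    if "0 \<le> s" "s \<le> h" "0 \<le> t" "t \<le> h" "h < r / N" "(a, b) = (u, v) \<or> (a, b) = (v, u)" for s t h a b
  proof -
    have "dist p (p + s *\<^sub>R a + t *\<^sub>R b) = norm (s *\<^sub>R a + t *\<^sub>R b)"
      by (metis add.assoc add_diff_cancel_left' dist_commute dist_norm)
    also have "\<dots> \<le> s * norm a + t * norm b"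
      using norm_triangle_ineq[of "s *\<^sub>R a" "t *\<^sub>R b"] that by simp
    also have "\<dots> \<le> h * norm a + h * norm b"
      using that by (intro add_mono mult_right_mono) auto
    also have "\<dots> \<le> h * N"
      using that by (auto simp: N_def algebra_simps)
    finally show *: "dist p (p + s *\<^sub>R a + t *\<^sub>R b) \<le> h * N" .
    have "h * N < r"
      using that N by (simp add: field_simps)
    then show "p + s *\<^sub>R a + t *\<^sub>R b \<in> S"
      using * r(2) by (auto simp: subset_iff)
  qed
  have key: "\<exists>x. dist p x \<le> h * N \<and>
      f (p + h *\<^sub>R a + h *\<^sub>R b) - f (p + h *\<^sub>R a) - f (p + h *\<^sub>R b) + f p = h * h * D (\<lambda>x. D f x a) x b"
    if h: "0 < h" "h < r / N" and ab: "(a, b) = (u, v) \<or> (a, b) = (v, u)" for a b h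
  proof -
    have sub: "(\<lambda>s. f (p + s *\<^sub>R a + t *\<^sub>R b)) differentiable at s \<and>
        ((\<lambda>s. f (p + s *\<^sub>R a + t *\<^sub>R b)) has_derivative (\<lambda>c. D f (p + s *\<^sub>R a + t *\<^sub>R b) (c *\<^sub>R a))) (at s)"
      if "0 \<le> s" "s \<le> h" "0 \<le> t" "t \<le> h" for s t
    proof -
      have "((\<lambda>s. p + s *\<^sub>R a + t *\<^sub>R b) has_derivative (\<lambda>c. c *\<^sub>R a)) (at s)"
        by (auto intro!: derivative_eq_intros)
      from has_derivative_compose[OF this has_derivative_D[OF diff(1)[OF inS[OF that h(2) ab]]]]
      show ?thesis
        by (auto simp: differentiable_def)
    qed
    have d1: "((\<lambda>s. f (p + s *\<^sub>R a + h *\<^sub>R b) - f (p + s *\<^sub>R a + 0 *\<^sub>R b)) has_real_derivative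
        (D f (p + s *\<^sub>R a + h *\<^sub>R b) a - D f (p + s *\<^sub>R a + 0 *\<^sub>R b) a)) (at s)" if "0 \<le> s" "s \<le> h" for s
    proof -
      have *: "0 \<le> h" "h \<le> h" "(0::real) \<le> 0"
        using h by auto
      have "(\<lambda>c. D f (p + s *\<^sub>R a + h *\<^sub>R b) (c *\<^sub>R a) - D f (p + s *\<^sub>R a + 0 *\<^sub>R b) (c *\<^sub>R a))
          = (*) (D f (p + s *\<^sub>R a + h *\<^sub>R b) a - D f (p + s *\<^sub>R a + 0 *\<^sub>R b) a)"
        using linear_scale[OF linear_D[OF diff(1)[OF inS[OF that *(1,2) h(2) ab]]]]
          linear_scale[OF linear_D[OF diff(1)[OF inS[OF that *(3,1) h(2) ab]]]]
        by (intro ext) (simp add: algebra_simps)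
      then show ?thesis
        using has_derivative_diff[OF conjunct2[OF sub[OF that *(1,2)]] conjunct2[OF sub[OF that *(3,1)]]]
        unfolding has_field_derivative_def by simp
    qed
    \<comment> \<open>Mean value theorem in direction a for the difference of f across the side h b;
      the second application, for t, is in direction b.\<close>
    obtain s where s: "0 < s" "s < h" and s2:
      "(f (p + h *\<^sub>R a + h *\<^sub>R b) - f (p + h *\<^sub>R a + 0 *\<^sub>R b)) - (f (p + 0 *\<^sub>R a + h *\<^sub>R b) - f (p + 0 *\<^sub>R a + 0 *\<^sub>R b))
       = (h - 0) * (D f (p + s *\<^sub>R a + h *\<^sub>R b) a - D f (p + s *\<^sub>R a + 0 *\<^sub>R b) a)"
      using MVT2[OF h(1), of "\<lambda>s. f (p + s *\<^sub>R a + h *\<^sub>R b) - f (p + s *\<^sub>R a + 0 *\<^sub>R b)", OF d1] by blast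
    have d2: "((\<lambda>t. D f (p + s *\<^sub>R a + t *\<^sub>R b) a) has_real_derivative
        D (\<lambda>x. D f x a) (p + s *\<^sub>R a + t *\<^sub>R b) b) (at t)" if "0 \<le> t" "t \<le> h" for t
    proof -
      have i: "p + s *\<^sub>R a + t *\<^sub>R b \<in> S"
        by (rule inS[OF _ _ that h(2) ab]) (use s in auto)
      have "((\<lambda>t. p + s *\<^sub>R a + t *\<^sub>R b) has_derivative (\<lambda>c. c *\<^sub>R b)) (at t)"
        by (auto intro!: derivative_eq_intros)
      note * = has_derivative_compose[OF this has_derivative_D[OF diff(2)[OF i, of a]]]
      have "(\<lambda>c. D (\<lambda>x. D f x a) (p + s *\<^sub>R a + t *\<^sub>R b) (c *\<^sub>R b)) = (*) (D (\<lambda>x. D f x a) (p + s *\<^sub>R a + t *\<^sub>R b) b)"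
        using linear_scale[OF linear_D[OF diff(2)[OF i, of a]]] by (intro ext) (simp add: mult.commute)
      then show ?thesis
        using * unfolding has_field_derivative_def by simp
    qed
    obtain t where t: "0 < t" "t < h" and t2:
      "D f (p + s *\<^sub>R a + h *\<^sub>R b) a - D f (p + s *\<^sub>R a + 0 *\<^sub>R b) a
        = (h - 0) * D (\<lambda>x. D f x a) (p + s *\<^sub>R a + t *\<^sub>R b) b"
      using MVT2[OF h(1), of "\<lambda>t. D f (p + s *\<^sub>R a + t *\<^sub>R b) a", OF d2] by blast
    show ?thesis
    proof (intro exI conjI)
      show "dist p (p + s *\<^sub>R a + t *\<^sub>R b) \<le> h * N"
        by (rule inB[OF _ _ _ _ h(2) ab]) (use s t in auto)
      show "f (p + h *\<^sub>R a + h *\<^sub>R b) - f (p + h *\<^sub>R a) - f (p + h *\<^sub>R b) + f p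
        = h * h * D (\<lambda>x. D f x a) (p + s *\<^sub>R a + t *\<^sub>R b) b"
        using s2 t2 by simp
    qed
  qed
  define G H where "G = (\<lambda>x. D (\<lambda>x. D f x u) x v)" and "H = (\<lambda>x. D (\<lambda>x. D f x v) x u)"
  have "\<bar>G p - H p\<bar> \<le> e" if e: "e > 0" for e
  proof -
    have "continuous (at p) G" "continuous (at p) H"
      using cont assms(1,2) by (auto simp: G_def H_def continuous_on_eq_continuous_at)
    then obtain d1 d2 where d: "d1 > 0" "d2 > 0" and dG: "\<And>x. dist p x < d1 \<Longrightarrow> dist (G x) (G p) < e/2"
      and dH: "\<And>x. dist p x < d2 \<Longrightarrow> dist (H x) (H p) < e/2"
      using e unfolding continuous_at_eps_delta by (metis dist_commute half_gt_zero)
    define m where "m = min (r/N) (min (d1/N) (d2/N))"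
    define h where "h = m / 2"
    have "m > 0"
      using r(1) d N by (simp add: m_def)
    then have "0 < h" "h < m"
      by (auto simp: h_def)
    moreover have "m \<le> r/N" "m \<le> d1/N" "m \<le> d2/N"
      by (auto simp: m_def)
    ultimately have "0 < h" "h < r/N" "h < d1/N" "h < d2/N"
      by linarith+
    then have h: "0 < h" "h < r / N" "h * N < d1" "h * N < d2"
      using N by (simp_all add: pos_less_divide_eq)
    obtain x where x: "dist p x \<le> h * N" "f (p + h *\<^sub>R u + h *\<^sub>R v) - f (p + h *\<^sub>R u) - f (p + h *\<^sub>R v) + f p = h * h * G x"
      using key[OF h(1,2), of u v] by (auto simp: G_def)
    obtain y where y: "dist p y \<le> h * N" "f (p + h *\<^sub>R v + h *\<^sub>R u) - f (p + h *\<^sub>R v) - f (p + h *\<^sub>R u) + f p = h * h * H y"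
      using key[OF h(1,2), of v u] by (auto simp: H_def)
    have "h * h * G x = h * h * H y"
      using x(2) y(2) by (simp add: algebra_simps)
    then have "G x = H y"
      using h(1) by simp
    moreover have "dist (G x) (G p) < e/2" "dist (H y) (H p) < e/2"
      using dG dH x y h by auto
    ultimately show ?thesis
      unfolding dist_real_def by linarith
  qed
  then show ?thesis
    unfolding G_def H_def by (meson abs_le_zero_iff dense_ge eq_iff_diff_eq_0)
qed

lemma D_bounded_linear:
  assumes "bounded_linear L" "f differentiable at p"
  shows "D (\<lambda>x. L (f x)) p v = L (D f p v)"
  by (rule D_eqI[OF bounded_linear.has_derivative[OF assms(1) has_derivative_D[OF assms(2)]]])

lemma D_D_commute:
  fixes f :: "'a::real_normed_vector \<Rightarrow> 'b::euclidean_space"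
  assumes "open S" "p \<in> S" "smooth_on S f"
  shows "D (\<lambda>x. D f x u) p v = D (\<lambda>x. D f x v) p u"
proof (rule euclidean_eqI)
  fix b :: 'b
  have sm: "smooth_on S (\<lambda>x. f x \<bullet> b)"
    using smooth_on_bounded_linear[OF assms(1) bounded_linear_inner_left assms(3)] .
  have eq: "D (\<lambda>x. D f x w \<bullet> b) p z = D (\<lambda>x. D (\<lambda>x. f x \<bullet> b) x w) p z" for w z
  proof (rule fun_cong[OF D_cong[OF assms(1,2)]])
    show "D (\<lambda>x. f x \<bullet> b) x w = D f x w \<bullet> b" if "x \<in> S" for x
      using D_bounded_linear[OF bounded_linear_inner_left smooth_on_differentiable[OF assms(3) that]] .
    show "(\<lambda>x. D (\<lambda>x. f x \<bullet> b) x w) differentiable at p"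
      using smooth_on_differentiable[OF smooth_on_D[OF sm] assms(2)] .
  qed
  have "D (\<lambda>x. D f x w) p z \<bullet> b = D (\<lambda>x. D f x w \<bullet> b) p z" for w z
    using D_bounded_linear[OF bounded_linear_inner_left smooth_on_differentiable[OF smooth_on_D[OF assms(3)] assms(2)]]
    by metis
  then show "D (\<lambda>x. D f x u) p v \<bullet> b = D (\<lambda>x. D f x v) p u \<bullet> b"
    using eq D_D_commute_real[OF assms(1,2), of "\<lambda>x. f x \<bullet> b"] sm by (metis smooth_on_def)
qed

section \<open>Local existence for ordinary differential equations\<close>

lemma has_vector_derivative_add_diff_const:
  assumes "(f has_vector_derivative f') net"
  shows "((\<lambda>t. a + (f t - b)) has_vector_derivative f') net"
  using has_vector_derivative_add[OF has_vector_derivative_const[of a]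
      has_vector_derivative_diff[OF assms has_vector_derivative_const[of b]]] by simp

text \<open>Banach's fixed point theorem for the Picard operator on bounded continuous functions on
  the whole line. Clamping the time to [-e, e] makes every iterate bounded and defined everywhere;
  the differential equation is claimed only on the open interval.\<close>

lemma picard_lipschitz:
  fixes f :: "'a::euclidean_space \<Rightarrow> 'a"
  assumes lip: "\<And>x y. norm (f x - f y) \<le> L * norm (x - y)" and bd: "\<And>x. norm (f x) \<le> B"
    and e: "e > 0" "3 * e * L \<le> 1 / 2" and L: "L \<ge> 0"
  obtains c where "c 0 = x0" "\<And>t. t \<in> {-e<..<e} \<Longrightarrow> (c has_vector_derivative f (c t)) (at t)"
    "\<And>t. norm (c t - x0) \<le> 3 * e * B"
proof -
  define cl where "cl = (\<lambda>t. max (-e) (min e t))"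
  have cl: "cl t \<in> {-e..e}" for t
    using e by (auto simp: cl_def)
  have clc: "continuous_on UNIV cl"
    unfolding cl_def by (intro continuous_intros)
  have contf: "continuous_on UNIV f"
  proof (rule lipschitz_on_continuous_on[of L])
    show "L-lipschitz_on UNIV f"
      using lip L by (auto simp: lipschitz_on_def dist_norm)
  qed
  have contg: "continuous_on A (\<lambda>t. f (apply_bcontfun g t))" for A g
    using continuous_on_compose2[OF contf continuous_on_apply_bcontfun] by auto
  have intg: "(\<lambda>t. f (apply_bcontfun g t)) integrable_on {-e..s}" for g s
    by (rule integrable_continuous_interval[OF contg])
  \<comment> \<open>The integral from 0 to the clamped time, written as a difference of integrals
    starting at -e so that both signs of t are covered at once. The two pieces have lengths at most
    2e and e, whence the factor 3 e in all estimates.\<close>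
  define J where "J = (\<lambda>h t. integral {-e..cl t} h - integral {-e..0} (h :: real \<Rightarrow> 'a))"
  have Jbound: "norm (J h t) \<le> 3 * e * C"
    if hC: "\<And>s. norm (h s) \<le> C" and hi: "\<And>s. h integrable_on {-e..s}" for h t C
  proof -
    have C: "0 \<le> C"
      using hC[of 0] norm_ge_zero order_trans by blast
    have "norm (integral {-e..s} h) \<le> C * (s - (-e))" if "s \<ge> -e" for s
    proof -
      have "norm (integral {-e..s} h) \<le> C * Henstock_Kurzweil_Integration.content {-e..s}"
        by (rule has_integral_bound_real[OF C finite.emptyI integrable_integral[OF hi[of s]]]) (rule hC)
      then show ?thesis
        using that by simp
    qed
    from this[of "cl t"] this[of 0] have "norm (integral {-e..cl t} h) \<le> C * (cl t + e)"
      "norm (integral {-e..0} h) \<le> C * e"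
      using cl[of t] e by auto
    moreover have "C * (cl t + e) \<le> C * (2 * e)"
      using C cl[of t] by (intro mult_left_mono) auto
    ultimately show ?thesis
      unfolding J_def using norm_triangle_ineq4[of "integral {-e..cl t} h" "integral {-e..0} h"]
      by (simp add: algebra_simps)
  qed
  define T where "T = (\<lambda>g t. x0 + J (\<lambda>s. f (apply_bcontfun g s)) t)"
  have Tb: "T g \<in> bcontfun" for g
  proof (rule bcontfun_normI)
    have "continuous_on {-e..e} (\<lambda>t. integral {-e..t} (\<lambda>s. f (apply_bcontfun g s)))"
      by (rule indefinite_integral_continuous_1[OF intg])
    then have "continuous_on UNIV (\<lambda>t. integral {-e..cl t} (\<lambda>s. f (apply_bcontfun g s)))"
      by (rule continuous_on_compose2[OF _ clc]) (use cl in auto)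
    then show "continuous_on UNIV (T g)"
      unfolding T_def J_def by (intro continuous_intros)
    show "norm (T g t) \<le> norm x0 + 3 * e * B" for t
      unfolding T_def using norm_triangle_mono[OF order_refl Jbound[OF bd intg]] .
  qed
  define G where "G = (\<lambda>g. Bcontfun (T g))"
  have G: "apply_bcontfun (G g) = T g" for g
    unfolding G_def using Bcontfun_inverse[OF Tb] .
  have contr: "dist (G g) (G h) \<le> 1/2 * dist g h" for g h
  proof (rule dist_bound)
    fix t
    have "dist (T g t) (T h t) = norm (J (\<lambda>s. f (apply_bcontfun g s) - f (apply_bcontfun h s)) t)"
      unfolding T_def J_def dist_norm by (simp add: integral_diff[OF intg intg] algebra_simps)
    also have "\<dots> \<le> 3 * e * (L * dist g h)"
    proof (rule Jbound)
      fix s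
      show "norm (f (apply_bcontfun g s) - f (apply_bcontfun h s)) \<le> L * dist g h"
        using lip[of "apply_bcontfun g s" "apply_bcontfun h s"] dist_bounded[of g s h] L
        by (smt (verit) dist_norm mult_left_mono)
      show "(\<lambda>t. f (apply_bcontfun g t) - f (apply_bcontfun h t)) integrable_on {-e..s}"
        by (intro integrable_diff intg)
    qed
    also have "\<dots> \<le> 1/2 * dist g h"
      using mult_right_mono[OF e(2) zero_le_dist[of g h]] by (simp add: mult.assoc)
    finally show "dist (apply_bcontfun (G g) t) (apply_bcontfun (G h) t) \<le> 1/2 * dist g h"
      by (simp add: G)
  qed
  have "\<exists>!g. G g = g"
    by (rule banach_fix_type[of "1/2"]) (use contr in auto)
  then obtain g where g: "G g = g"
    by blast
  define c where "c = apply_bcontfun g"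
  have c: "c t = x0 + J (\<lambda>s. f (c s)) t" for t
  proof -
    have "c t = T g t"
      unfolding c_def using G[of g] g by simp
    then show ?thesis
      by (simp add: T_def c_def)
  qed
  show ?thesis
  proof
    show "c 0 = x0"
      using e by (subst c) (simp add: J_def cl_def)
    show "norm (c t - x0) \<le> 3 * e * B" for t
      by (subst c) (use Jbound[OF bd intg, of g t] in \<open>simp add: c_def\<close>)
    fix t assume t: "t \<in> {-e<..<e}"
    have "((\<lambda>t. integral {-e..t} (\<lambda>s. f (c s))) has_vector_derivative f (c t)) (at t within {-e..e})"
      unfolding c_def by (rule integral_has_vector_derivative[OF contg]) (use t in auto)
    moreover have "at t within {-e..e} = at t"
      by (rule at_within_Icc_at) (use t in auto)
    ultimately have "((\<lambda>t. x0 + (integral {-e..t} (\<lambda>s. f (c s)) - integral {-e..0} (\<lambda>s. f (c s)))) has_vector_derivative f (c t)) (at t)"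
      using has_vector_derivative_add_diff_const by metis
    then show "(c has_vector_derivative f (c t)) (at t)"
    proof (rule has_vector_derivative_transform_within_open[OF _ open_greaterThanLessThan t])
      fix s assume "s \<in> {-e<..<e}"
      then have "cl s = s"
        by (auto simp: cl_def)
      then show "x0 + (integral {-e..s} (\<lambda>s. f (c s)) - integral {-e..0} (\<lambda>s. f (c s))) = c s"
        using c[of s] by (simp add: J_def)
    qed
  qed
qed

text \<open>To make f globally Lipschitz and bounded, it is composed with the nearest-point
  projection onto a closed ball \<open>Q\<close> around x0. The solution cannot leave
  \<open>Q\<close> in the short time allowed, and on \<open>Q\<close> the projection is the
  identity.\<close>

theorem picard_lindelof_local:
  fixes f :: "'a::euclidean_space \<Rightarrow> 'a"
  assumes "open S" "x0 \<in> S" "smooth_on S f"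
  obtains e c where "e > 0" "c 0 = x0"
    "\<And>t. t \<in> {-e<..<e} \<Longrightarrow> c t \<in> S \<and> (c has_vector_derivative f (c t)) (at t)"
proof -
  obtain r where r: "r > 0" "cball x0 r \<subseteq> S"
    using assms(1,2) open_contains_cball by blast
  define Q where "Q = cball x0 r"
  have Q: "convex Q" "closed Q" "Q \<noteq> {}" "compact Q" "Q \<subseteq> S"
    using r by (auto simp: Q_def)
  have "continuous_on Q (\<lambda>x. \<Sum>b\<in>Basis. norm (D f x b))"
    by (intro continuous_intros continuous_on_subset[OF smooth_on_continuous[OF smooth_on_D[OF assms(3)]] Q(5)])
  then have "bounded ((\<lambda>x. \<Sum>b\<in>Basis. norm (D f x b)) ` Q)"
    using Q(4) compact_continuous_image compact_imp_bounded by blast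
  then obtain L where L: "L > 0" "\<And>x. x \<in> Q \<Longrightarrow> norm (\<Sum>b\<in>Basis. norm (D f x b)) \<le> L"
    by (auto simp: bounded_pos)
  have "continuous_on Q f"
    using continuous_on_subset[OF smooth_on_continuous[OF assms(3)] Q(5)] .
  then have "bounded (f ` Q)"
    using Q(4) compact_continuous_image compact_imp_bounded by blast
  then obtain B where B: "B > 0" "\<And>x. x \<in> Q \<Longrightarrow> norm (f x) \<le> B"
    by (auto simp: bounded_pos)
  have lipQ: "norm (f x - f y) \<le> L * norm (x - y)" if "x \<in> Q" "y \<in> Q" for x y
  proof (rule differentiable_bound[OF Q(1) _ _ that(1,2)])
    fix z assume z: "z \<in> Q"
    then have d: "f differentiable at z"
      using smooth_on_differentiable[OF assms(3)] Q(5) by auto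
    show "(f has_derivative D f z) (at z within Q)"
      using has_derivative_at_withinI[OF has_derivative_D[OF d]] .
    have "onorm (D f z) \<le> (\<Sum>b\<in>Basis. norm (D f z b))"
      using onorm_componentwise[OF bounded_linear_D[OF d]] .
    also have "\<dots> \<le> L"
      using L(2)[OF z] by simp
    finally show "onorm (D f z) \<le> L" .
  qed
  define h where "h = (\<lambda>x. f (closest_point Q x))"
  have cp: "closest_point Q x \<in> Q" for x
    using closest_point_in_set Q by blast
  \<comment> \<open>The bound 1 / (6 L) gives 3 e L <= 1/2, the contraction; r / (3 B) gives 3 e B
    <= r, which confines the curve to \<open>Q\<close>.\<close>
  define e where "e = min (1 / (6 * L)) (r / (3 * B))"
  have e: "e > 0" "3 * e * L \<le> 1/2" "3 * e * B \<le> r"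
  proof -
    show "e > 0"
      using L B r by (simp add: e_def)
    have "e \<le> 1 / (6 * L)" "e \<le> r / (3 * B)"
      by (auto simp: e_def)
    then show "3 * e * L \<le> 1/2" "3 * e * B \<le> r"
      using L B by (simp_all add: field_simps)
  qed
  have "norm (h x - h y) \<le> L * norm (x - y)" for x y
  proof -
    have "norm (h x - h y) \<le> L * norm (closest_point Q x - closest_point Q y)"
      unfolding h_def using lipQ cp by blast
    also have "\<dots> \<le> L * norm (x - y)"
      using closest_point_lipschitz[OF Q(1-3), of x y] L(1) by (simp add: dist_norm)
    finally show ?thesis .
  qed
  moreover have "norm (h x) \<le> B" for x
    unfolding h_def using B(2) cp by blast
  ultimately obtain c where c: "c 0 = x0" "\<And>t. t \<in> {-e<..<e} \<Longrightarrow> (c has_vector_derivative h (c t)) (at t)"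
    "\<And>t. norm (c t - x0) \<le> 3 * e * B"
    using picard_lipschitz[of h L B e x0] e L(1) by (metis less_imp_le)
  have inQ: "c t \<in> Q" for t
    using c(3)[of t] e(3) by (simp add: Q_def dist_norm norm_minus_commute)
  then have "h (c t) = f (c t)" for t
    unfolding h_def using closest_point_self by metis
  then have *: "c t \<in> S \<and> (c has_vector_derivative f (c t)) (at t)" if "t \<in> {-e<..<e}" for t
    using c(2)[OF that] inQ Q(5) by auto
  show ?thesis
    by (rule that[of e c]) (fact e(1) c(1) *)+
qed

section \<open>Parametrised multilinear maps and moving frames\<close>

lemma linear_param_D:
  fixes A :: "'a::real_normed_vector \<Rightarrow> 'c::euclidean_space \<Rightarrow> 'e::real_normed_vector"
  assumes S: "open S" "p \<in> S" and lin: "\<And>q. q \<in> S \<Longrightarrow> linear (A q)"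
    and diff: "\<And>c. (\<lambda>q. A q c) differentiable at p"
  shows "linear (\<lambda>c. D (\<lambda>q. A q c) p v)"
proof
  fix a b :: 'c and r :: real
  have "((\<lambda>q. A q (a + b)) has_derivative (\<lambda>v. D (\<lambda>q. A q a) p v + D (\<lambda>q. A q b) p v)) (at p)"
    by (rule has_derivative_transform_within_open[OF has_derivative_add[OF has_derivative_D has_derivative_D] S])
      (use diff linear_add[OF lin] in auto)
  then show "D (\<lambda>q. A q (a + b)) p v = D (\<lambda>q. A q a) p v + D (\<lambda>q. A q b) p v"
    by (rule D_eqI)
  have "((\<lambda>q. A q (r *\<^sub>R a)) has_derivative (\<lambda>v. r *\<^sub>R D (\<lambda>q. A q a) p v)) (at p)"
    by (rule has_derivative_transform_within_open[OF has_derivative_scaleR_right[OF has_derivative_D] S])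
      (use diff linear_scale[OF lin] in auto)
  then show "D (\<lambda>q. A q (r *\<^sub>R a)) p v = r *\<^sub>R D (\<lambda>q. A q a) p v"
    by (rule D_eqI)
qed

text \<open>Product rule for a family of linear maps known to be differentiable only for each fixed
  argument. In finite dimension this suffices: expand \<open>Y q\<close> in \<open>Basis\<close> and
  differentiate a finite sum.\<close>

lemma has_derivative_linear_param:
  fixes A :: "'a::real_normed_vector \<Rightarrow> 'c::euclidean_space \<Rightarrow> 'e::real_normed_vector"
  assumes S: "open S" "p \<in> S" and lin: "\<And>q. q \<in> S \<Longrightarrow> linear (A q)"
    and diff: "\<And>c. (\<lambda>q. A q c) differentiable at p" and Y: "(Y has_derivative Y') (at p)"
  shows "((\<lambda>q. A q (Y q)) has_derivative (\<lambda>v. D (\<lambda>q. A q (Y p)) p v + A p (Y' v))) (at p)"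
proof -
  have "((\<lambda>q. \<Sum>b\<in>Basis. (Y q \<bullet> b) *\<^sub>R A q b) has_derivative
      (\<lambda>v. \<Sum>b\<in>Basis. (Y p \<bullet> b) *\<^sub>R D (\<lambda>q. A q b) p v + (Y' v \<bullet> b) *\<^sub>R A p b)) (at p)"
    by (intro has_derivative_sum has_derivative_scaleR has_derivative_inner_left Y has_derivative_D diff)
  also have "(\<lambda>v. \<Sum>b\<in>Basis. (Y p \<bullet> b) *\<^sub>R D (\<lambda>q. A q b) p v + (Y' v \<bullet> b) *\<^sub>R A p b)
      = (\<lambda>v. D (\<lambda>q. A q (Y p)) p v + A p (Y' v))"
  proof
    fix v
    show "(\<Sum>b\<in>Basis. (Y p \<bullet> b) *\<^sub>R D (\<lambda>q. A q b) p v + (Y' v \<bullet> b) *\<^sub>R A p b)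
      = D (\<lambda>q. A q (Y p)) p v + A p (Y' v)"
      using linear_expand[OF linear_param_D[OF S lin diff, of v], of "Y p"] linear_expand[OF lin[OF S(2)], of "Y' v"]
      by (simp add: sum.distrib)
  qed
  finally show ?thesis
    by (rule has_derivative_transform_within_open[OF _ S]) (simp add: linear_expand[OF lin, symmetric])
qed

lemma smooth_on_linear_param:
  fixes A :: "'a::real_normed_vector \<Rightarrow> 'c::euclidean_space \<Rightarrow> 'e::real_normed_vector"
  assumes S: "open S" and lin: "\<And>q. q \<in> S \<Longrightarrow> linear (A q)"
    and sm: "\<And>c. smooth_on S (\<lambda>q. A q c)" "smooth_on S Y"
  shows "smooth_on S (\<lambda>q. A q (Y q))"
proof (rule smooth_on_cong[OF S])
  show "smooth_on S (\<lambda>q. \<Sum>b\<in>Basis. (Y q \<bullet> b) *\<^sub>R A q b)"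
    by (intro smooth_on_sum[OF S] smooth_on_scaleR[OF S] sm
        smooth_on_bounded_linear[OF S bounded_linear_inner_left])
qed (simp add: linear_expand[OF lin, symmetric])

lemma bilinear_linear: "bilinear h \<Longrightarrow> linear (h x)" "bilinear h \<Longrightarrow> linear (\<lambda>x. h x y)"
  by (auto simp: bilinear_def)

lemma smooth_on_bilinear_param:
  fixes G :: "'b::euclidean_space \<Rightarrow> 'c::euclidean_space \<Rightarrow> 'd::euclidean_space \<Rightarrow> 'e::real_normed_vector"
    and g :: "'a::real_normed_vector \<Rightarrow> 'b"
  assumes S: "open S" and g: "g ` S \<subseteq> M" "smooth_on S g"
    and bil: "\<And>y. y \<in> M \<Longrightarrow> bilinear (G y)" and sm: "\<And>c d. smooth_on M (\<lambda>y. G y c d)"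
    and aw: "smooth_on S a" "smooth_on S w"
  shows "smooth_on S (\<lambda>q. G (g q) (a q) (w q))"
proof -
  have bil': "bilinear (G (g q))" if "q \<in> S" for q
    using bil g that by auto
  have "smooth_on S (\<lambda>q. G (g q) c d)" for c d
    using smooth_on_compose[OF S g(2) sm g(1)] .
  then have "smooth_on S (\<lambda>q. G (g q) (a q) d)" for d
    using smooth_on_linear_param[OF S, of "\<lambda>q c. G (g q) c d" a] bil' aw bilinear_linear by blast
  then show ?thesis
    using smooth_on_linear_param[OF S, of "\<lambda>q d. G (g q) (a q) d" w] bil' aw bilinear_linear by blast
qed

text \<open>Made for Christoffel symbols evaluated along a map: base point, direction and section
  all vary with q, and each contributes one term.\<close>

lemma has_derivative_bilinear_param:
  fixes G :: "'b::euclidean_space \<Rightarrow> 'c::euclidean_space \<Rightarrow> 'd::euclidean_space \<Rightarrow> 'e::real_normed_vector"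
    and g :: "'a::real_normed_vector \<Rightarrow> 'b"
  assumes S: "open S" "p \<in> S" and g: "g ` S \<subseteq> M" "(g has_derivative g') (at p)"
    and bil: "\<And>y. y \<in> M \<Longrightarrow> bilinear (G y)" and sm: "\<And>c d. smooth_on M (\<lambda>y. G y c d)"
    and a: "(a has_derivative a') (at p)" and w: "(w has_derivative w') (at p)"
  shows "((\<lambda>q. G (g q) (a q) (w q)) has_derivative
    (\<lambda>v. D (\<lambda>y. G y (a p) (w p)) (g p) (g' v) + G (g p) (a' v) (w p) + G (g p) (a p) (w' v))) (at p)"
proof -
  have bil': "bilinear (G (g q))" if "q \<in> S" for q
    using bil g that by auto
  have gp: "g p \<in> M"
    using g S by auto
  have d0: "((\<lambda>q. G (g q) c d) has_derivative (\<lambda>v. D (\<lambda>y. G y c d) (g p) (g' v))) (at p)" for c d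
    using has_derivative_compose[OF g(2) has_derivative_D[OF smooth_on_differentiable[OF sm gp]]] .
  have d1: "((\<lambda>q. G (g q) (a q) d) has_derivative
      (\<lambda>v. D (\<lambda>y. G y (a p) d) (g p) (g' v) + G (g p) (a' v) d)) (at p)" for d
    using has_derivative_linear_param[OF S, of "\<lambda>q c. G (g q) c d" a a'] bil' a bilinear_linear(2)
      differentiableI[OF d0] D_eqI[OF d0] by auto
  show ?thesis
    using has_derivative_linear_param[OF S, of "\<lambda>q d. G (g q) (a q) d" w w'] bil' w bilinear_linear(1)
      differentiableI[OF d1] D_eqI[OF d1] by auto
qed

lemma has_derivative_D_apply:
  fixes f :: "'a::euclidean_space \<Rightarrow> 'b::real_normed_vector"
  assumes S: "open S" "p \<in> S" and f: "smooth_on S f" and Y: "(Y has_derivative Y') (at p)"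
  shows "((\<lambda>q. D f q (Y q)) has_derivative (\<lambda>v. D (\<lambda>q. D f q (Y p)) p v + D f p (Y' v))) (at p)"
  by (rule has_derivative_linear_param[OF S _ _ Y])
    (use linear_D smooth_on_differentiable[OF f] smooth_on_differentiable[OF smooth_on_D[OF f]] S in auto)

lemma smooth_on_D_apply:
  fixes f :: "'a::euclidean_space \<Rightarrow> 'b::real_normed_vector"
  assumes S: "open S" and f: "smooth_on S f" and Y: "smooth_on S Y"
  shows "smooth_on S (\<lambda>q. D f q (Y q))"
  by (rule smooth_on_linear_param[OF S _ smooth_on_D[OF f] Y])
    (use linear_D smooth_on_differentiable[OF f] in auto)

lemma sum_axis: "(\<Sum>j\<in>UNIV. x $ j *\<^sub>R axis j 1) = (x :: real^'n)"
  using basis_expansion[of x] by (simp add: scalar_mult_eq_scaleR)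

section \<open>Coordinates with respect to a moving frame\<close>

locale index_bij =
  fixes ix :: "nat \<Rightarrow> 'n::finite" and k :: nat
  assumes ix: "bij_betw ix {..k} UNIV"
begin

lemma sum_ix: "(\<Sum>j\<in>UNIV. f j) = (\<Sum>i\<le>k. f (ix i))"
  using sum.reindex_bij_betw[OF ix, of f] by simp

lemma ix_eq_iff: "i \<le> k \<Longrightarrow> j \<le> k \<Longrightarrow> ix i = ix j \<longleftrightarrow> i = j"
  using ix by (auto simp: bij_betw_def inj_on_def)

lemma ix_cases: obtains i where "i \<le> k" "j = ix i"
  using ix by (metis UNIV_I atMost_iff bij_betw_imp_surj_on image_iff)

definition frame_matrix :: "(nat \<Rightarrow> real^'n) \<Rightarrow> real^'n^'n" where
  "frame_matrix b = (\<chi> r c. b (inv_into {..k} ix c) $ r)"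

definition frame :: "(nat \<Rightarrow> real^'n) \<Rightarrow> bool" where
  "frame b \<longleftrightarrow> det (frame_matrix b) \<noteq> 0"

text \<open>\<open>matrix_inv\<close> is a total function, so linearity in \<open>w\<close> holds
  for every family \<open>b\<close>; for a \<open>frame\<close> these are the coefficients of
  \<open>w\<close>.\<close>

definition coord :: "(nat \<Rightarrow> real^'n) \<Rightarrow> real^'n \<Rightarrow> nat \<Rightarrow> real" where
  "coord b w i = (matrix_inv (frame_matrix b) *v w) $ ix i"

lemma inv_ix: "i \<le> k \<Longrightarrow> inv_into {..k} ix (ix i) = i"
  using ix by (auto simp: bij_betw_def)

lemma frame_matrix_mult: "frame_matrix b *v x = (\<Sum>i\<le>k. x $ ix i *\<^sub>R b i)"
  unfolding vec_eq_iff
  by (auto simp: matrix_vector_mult_def frame_matrix_def sum_ix inv_ix mult.commute intro!: sum.cong)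

lemma frameI:
  assumes "\<And>w. \<exists>c. w = (\<Sum>i\<le>k. c i *\<^sub>R b i)"
  shows "frame b"
proof -
  have "\<exists>x. w = frame_matrix b *v x" for w
  proof -
    obtain c where "w = (\<Sum>i\<le>k. c i *\<^sub>R b i)"
      using assms by blast
    then have "w = frame_matrix b *v (\<chi> j. c (inv_into {..k} ix j))"
      by (simp add: frame_matrix_mult inv_ix)
    then show ?thesis ..
  qed
  then have "surj ((*v) (frame_matrix b))"
    by (auto simp: surj_def)
  then show ?thesis
    unfolding frame_def using matrix_right_invertible_surjective invertible_right_inverse invertible_det_nz by blast
qed

lemma is_basis_frame: "is_basis k b \<Longrightarrow> frame b"
proof (rule frameI)
  fix w :: "real^'n"
  assume "is_basis k b"
  then have "w \<in> span (b ` {..k})" "inj_on b {..k}"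
    by (auto simp: is_basis_def)
  then obtain u where "w = (\<Sum>v\<in>b ` {..k}. u v *\<^sub>R v)"
    unfolding span_finite[OF finite_imageI[OF finite_atMost]] by auto
  with \<open>inj_on b {..k}\<close> have "w = (\<Sum>i\<le>k. u (b i) *\<^sub>R b i)"
    by (simp add: sum.reindex)
  then show "\<exists>c. w = (\<Sum>i\<le>k. c i *\<^sub>R b i)"
    by (intro exI[of _ "\<lambda>i. u (b i)"])
qed

lemma frame_matrix_inv:
  assumes "frame b"
  shows "frame_matrix b ** matrix_inv (frame_matrix b) = mat 1"
    "matrix_inv (frame_matrix b) ** frame_matrix b = mat 1"
proof -
  have "invertible (frame_matrix b)"
    using assms by (simp add: frame_def invertible_det_nz)
  then have "\<exists>B. frame_matrix b ** B = mat 1 \<and> B ** frame_matrix b = mat 1"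
    by (simp add: invertible_def)
  then show "frame_matrix b ** matrix_inv (frame_matrix b) = mat 1"
    "matrix_inv (frame_matrix b) ** frame_matrix b = mat 1"
    unfolding matrix_inv_def by (metis (mono_tags, lifting) someI_ex)+
qed

lemma coord_sum: "frame b \<Longrightarrow> (\<Sum>i\<le>k. coord b w i *\<^sub>R b i) = w"
  using frame_matrix_mult[of b "matrix_inv (frame_matrix b) *v w"]
  by (simp add: coord_def matrix_vector_mul_assoc frame_matrix_inv)

lemma linear_coord: "linear (\<lambda>w. coord b w i)"
proof -
  have "linear ((\<lambda>x. x $ ix i) \<circ> ((*v) (matrix_inv (frame_matrix b))))"
    by (intro linear_compose matrix_vector_mul_linear bounded_linear.linear bounded_linear_vec_nth)
  then show ?thesis
    by (simp add: coord_def[abs_def] o_def)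
qed

lemmas coord_simps = linear_add[OF linear_coord] linear_scale[OF linear_coord] linear_diff[OF linear_coord]
  linear_neg[OF linear_coord] linear_sum[OF linear_coord] linear_0[OF linear_coord]

lemma coord_unique:
  assumes "frame b" "w = (\<Sum>i\<le>k. c i *\<^sub>R b i)" "i \<le> k"
  shows "coord b w i = c i"
proof -
  have "w = frame_matrix b *v (\<chi> j. c (inv_into {..k} ix j))"
    using assms(2) by (simp add: frame_matrix_mult inv_ix)
  then have "matrix_inv (frame_matrix b) *v w = (\<chi> j. c (inv_into {..k} ix j))"
    using assms(1) by (simp add: matrix_vector_mul_assoc frame_matrix_inv)
  then show ?thesis
    using assms(3) by (simp add: coord_def inv_ix)
qed

lemma coord_basis: "frame b \<Longrightarrow> i \<le> k \<Longrightarrow> j \<le> k \<Longrightarrow> coord b (b i) j = (if j = i then 1 else 0)"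
  by (rule coord_unique) (auto simp: if_distrib[of "\<lambda>c. c *\<^sub>R _"] cong: if_cong)

lemma coord_eqI: "frame b \<Longrightarrow> (\<And>i. i \<le> k \<Longrightarrow> coord b v i = coord b w i) \<Longrightarrow> v = w"
  using coord_sum by (metis (no_types, lifting) atMost_iff sum.cong)

text \<open>By Cramer's rule a coordinate is a quotient of determinants, which are polynomials in
  smooth entries, and the denominator does not vanish on frames.\<close>

lemma smooth_on_coord:
  fixes b :: "'a::real_normed_vector \<Rightarrow> nat \<Rightarrow> real^'n"
  assumes S: "open S" and b: "\<And>i. i \<le> k \<Longrightarrow> smooth_on S (\<lambda>q. b q i)" and fr: "\<And>q. q \<in> S \<Longrightarrow> frame (b q)"
    and w: "smooth_on S w"
  shows "smooth_on S (\<lambda>q. coord (b q) (w q) i)"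
proof (rule smooth_on_cong[OF S])
  have ent: "smooth_on S (\<lambda>q. frame_matrix (b q) $ r $ c)" for r c
  proof -
    have "inv_into {..k} ix c \<le> k"
      using inv_into_into[of c ix "{..k}"] ix by (simp add: bij_betw_def)
    from smooth_on_vec_nth[OF S b[OF this]] show ?thesis
      by (simp add: frame_matrix_def)
  qed
  show "smooth_on S (\<lambda>q. det (\<chi> r c. if c = ix i then w q $ r else frame_matrix (b q) $ r $ c) / det (frame_matrix (b q)))"
  proof (intro smooth_on_divide[OF S] smooth_on_det[OF S] ent)
    show "smooth_on S (\<lambda>q. (\<chi> r c. if c = ix i then w q $ r else frame_matrix (b q) $ r $ c) $ r $ c)" for r c
      using ent[of r c] smooth_on_vec_nth[OF S w, of r] by (cases "c = ix i") auto
  qed (use fr in \<open>simp add: frame_def\<close>)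
  fix q assume "q \<in> S"
  then have nz: "det (frame_matrix (b q)) \<noteq> 0"
    using fr by (simp add: frame_def)
  have "frame_matrix (b q) *v (matrix_inv (frame_matrix (b q)) *v w q) = w q"
    using frame_matrix_inv(1)[OF fr[OF \<open>q \<in> S\<close>]] by (simp add: matrix_vector_mul_assoc)
  then have "matrix_inv (frame_matrix (b q)) *v w q =
    (\<chi> c. det (\<chi> i j. if j = c then w q $ i else frame_matrix (b q) $ i $ j) / det (frame_matrix (b q)))"
    using cramer[OF nz] by blast
  then show "det (\<chi> r c. if c = ix i then w q $ r else frame_matrix (b q) $ r $ c) / det (frame_matrix (b q))
    = coord (b q) (w q) i"
    unfolding coord_def by simp
qed

text \<open>\<open>trace\<close> is defined in the standard basis. Expanding that basis in
  \<open>b\<close> and exchanging the sums moves the computation to any frame, in particular to one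
  adapted to the null direction.\<close>

lemma trace_coord:
  assumes "frame b" "linear L"
  shows "trace (matrix L) = (\<Sum>i\<le>k. coord b (L (b i)) i)"
proof -
  have "trace (matrix L) = (\<Sum>j\<in>UNIV. L (axis j 1) $ j)"
    by (simp add: trace_def matrix_def)
  also have "\<dots> = (\<Sum>j\<in>UNIV. \<Sum>i\<le>k. coord b (axis j 1) i * L (b i) $ j)"
  proof (intro sum.cong refl)
    fix j :: 'n
    have "L (axis j 1) = L (\<Sum>i\<le>k. coord b (axis j 1) i *\<^sub>R b i)"
      by (simp add: coord_sum[OF assms(1)])
    then show "L (axis j 1) $ j = (\<Sum>i\<le>k. coord b (axis j 1) i * L (b i) $ j)"
      by (simp add: linear_sum[OF assms(2)] linear_scale[OF assms(2)])
  qed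
  also have "\<dots> = (\<Sum>i\<le>k. \<Sum>j\<in>UNIV. L (b i) $ j * coord b (axis j 1) i)"
    by (subst sum.swap) (simp add: mult.commute)
  also have "\<dots> = (\<Sum>i\<le>k. coord b (\<Sum>j\<in>UNIV. L (b i) $ j *\<^sub>R axis j 1) i)"
    by (simp add: coord_simps)
  also have "\<dots> = (\<Sum>i\<le>k. coord b (L (b i)) i)"
    by (simp only: sum_axis)
  finally show ?thesis .
qed

end

section \<open>The jet space, its frame and the lifted connection\<close>

locale jet_quotient = index_bij ix k for ix :: "nat \<Rightarrow> 'n::finite" and k :: nat +
  fixes F :: "'n jet \<Rightarrow> real" and U :: "'n jet set" and \<pi> :: "'n jet \<Rightarrow> real^'n" and M :: "(real^'n) set"
  assumes sol: "solution_space ix k F U \<pi> M" and k2: "k \<ge> 2"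
begin

abbreviation X :: "'n jet \<Rightarrow> 'n jet" where
  "X \<equiv> total_derivative ix k F"

abbreviation d :: "nat \<Rightarrow> 'n jet" where
  "d \<equiv> jet_partial ix"

definition E :: "nat \<Rightarrow> 'n jet \<Rightarrow> real^'n" where
  "E i p = D \<pi> p (d i)"

text \<open>The coframe dual to the E_i. It depends on the jet \<open>p\<close> and not merely on
  its projection, since the E_i do.\<close>

abbreviation eps :: "nat \<Rightarrow> 'n jet \<Rightarrow> real^'n \<Rightarrow> real" where
  "eps l p w \<equiv> coord (\<lambda>i. E i p) w l"

lemma open_U: "open U" and open_M: "open M" and smooth_F: "smooth_on U F" and smooth_pi: "smooth_on U \<pi>"
  and pi_image: "\<pi> ` U = M"
  using sol by (auto simp: solution_space_def)

lemma pi_in_M: "p \<in> U \<Longrightarrow> \<pi> p \<in> M"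
  using pi_image by auto

lemma surj_D_pi: "p \<in> U \<Longrightarrow> range (D \<pi> p) = UNIV" and D_pi_X: "p \<in> U \<Longrightarrow> D \<pi> p (X p) = 0"
  using sol unfolding solution_space_def by blast+

lemma diff_pi: "p \<in> U \<Longrightarrow> \<pi> differentiable at p"
  using smooth_on_differentiable[OF smooth_pi] .

lemmas linear_D_pi = linear_D[OF diff_pi]

lemma smooth_E: "smooth_on U (E i)"
  unfolding E_def[abs_def] by (rule smooth_on_D[OF smooth_pi])

lemma jet_decomp: "v = fst v *\<^sub>R jet_t + (\<Sum>i\<le>k. (snd v $ ix i) *\<^sub>R d i)"
proof (rule prod_eqI)
  show "fst v = fst (fst v *\<^sub>R jet_t + (\<Sum>i\<le>k. (snd v $ ix i) *\<^sub>R d i))"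
    by (simp add: jet_t_def jet_partial_def fst_sum)
  have "snd v = (\<Sum>j\<in>UNIV. snd v $ j *\<^sub>R axis j 1)"
    by (simp only: sum_axis)
  then show "snd v = snd (fst v *\<^sub>R jet_t + (\<Sum>i\<le>k. (snd v $ ix i) *\<^sub>R d i))"
    by (simp add: jet_t_def jet_partial_def snd_sum sum_ix)
qed

lemma snd_d_nth: "i \<le> k \<Longrightarrow> j \<le> k \<Longrightarrow> snd (d i) $ ix j = (if i = j then 1 else 0)"
  by (auto simp: jet_partial_def axis_def ix_eq_iff)

lemma fst_X: "fst (X p) = 1"
  by (simp add: total_derivative_def jet_t_def jet_partial_def fst_sum)

lemma D_pi_vertical:
  assumes "p \<in> U" "fst v = 0"
  shows "D \<pi> p v = (\<Sum>i\<le>k. (snd v $ ix i) *\<^sub>R E i p)"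
proof -
  have "v = (\<Sum>i\<le>k. (snd v $ ix i) *\<^sub>R d i)"
    using jet_decomp[of v] assms(2) by simp
  then have "D \<pi> p v = D \<pi> p (\<Sum>i\<le>k. (snd v $ ix i) *\<^sub>R d i)"
    by (rule arg_cong)
  then show ?thesis
    by (simp add: E_def linear_sum[OF linear_D_pi[OF assms(1)]] linear_scale[OF linear_D_pi[OF assms(1)]])
qed

text \<open>\<open>D \<pi> p\<close> is onto and kills \<open>X p\<close>, whose t-component is 1.
  Subtracting a multiple of \<open>X p\<close> from a preimage makes it a combination of the d_i, so
  the k + 1 vectors E_i span.\<close>

lemma frame_E:
  assumes "p \<in> U"
  shows "frame (\<lambda>i. E i p)"
proof (rule frameI)
  fix w
  obtain v where w: "w = D \<pi> p v"
    using surj_D_pi[OF assms] by blast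
  define u where "u = v - fst v *\<^sub>R X p"
  have "D \<pi> p u = w"
    using linear_D_pi[OF assms] by (simp add: u_def w linear_diff linear_scale D_pi_X[OF assms])
  moreover have "fst u = 0"
    by (simp add: u_def fst_X)
  ultimately show "\<exists>c. w = (\<Sum>i\<le>k. c i *\<^sub>R E i p)"
    using D_pi_vertical[OF assms] by metis
qed

lemma eps_E: "p \<in> U \<Longrightarrow> i \<le> k \<Longrightarrow> l \<le> k \<Longrightarrow> eps l p (E i p) = (if l = i then 1 else 0)"
  using coord_basis[OF frame_E] .

lemma E_nonzero: "p \<in> U \<Longrightarrow> i \<le> k \<Longrightarrow> E i p \<noteq> 0"
  using eps_E[of p i i] coord_simps(6) by fastforce

lemma smooth_eps:
  assumes "open T" "T \<subseteq> U" "smooth_on T w"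
  shows "smooth_on T (\<lambda>q. eps l q (w q))"
  by (rule smooth_on_coord[OF assms(1) _ _ assms(3)])
    (use smooth_on_subset[OF smooth_E assms(2)] frame_E assms(2) in auto)

lemma has_derivative_X:
  assumes "p \<in> U"
  shows "(X has_derivative (\<lambda>v. (\<Sum>i<k. (snd v $ ix (Suc i)) *\<^sub>R d i) + D F p v *\<^sub>R d k)) (at p)"
proof -
  have F: "(F has_derivative D F p) (at p)"
    by (rule has_derivative_D[OF smooth_on_differentiable[OF smooth_F assms]])
  have "((\<lambda>q. snd q $ j) has_derivative (\<lambda>v. snd v $ j)) (at p)" for j
    by (rule bounded_linear_imp_has_derivative) (rule bounded_linear_compose[OF bounded_linear_vec_nth bounded_linear_snd])
  then have "((\<lambda>q. jet_t + (\<Sum>i<k. (snd q $ ix (Suc i)) *\<^sub>R d i) + F q *\<^sub>R d k) has_derivative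
      (\<lambda>v. 0 + (\<Sum>i<k. (snd v $ ix (Suc i)) *\<^sub>R d i) + D F p v *\<^sub>R d k)) (at p)"
    by (intro has_derivative_add has_derivative_const has_derivative_sum has_derivative_scaleR_left F)
  then show ?thesis
    by (simp add: total_derivative_def[abs_def])
qed

lemma smooth_X: "smooth_on U X"
  unfolding total_derivative_def[abs_def]
  by (intro smooth_on_add[OF open_U] smooth_on_sum[OF open_U] smooth_on_scaleR[OF open_U] smooth_on_const smooth_F
      smooth_on_bounded_linear[OF open_U bounded_linear_compose[OF bounded_linear_vec_nth bounded_linear_snd]]
      smooth_on_ident[OF open_U])

text \<open>The field d_i is constant, so this is the bracket of d_i with the total derivative. The
  lowering of the index comes from the coefficient x_i of d_{i-1} in X; all later shifts originate
  here.\<close>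

lemma D_X_d:
  assumes "p \<in> U" "i \<le> k"
  shows "D X p (d i) = (if i = 0 then 0 else d (i - 1)) + D F p (d i) *\<^sub>R d k"
proof -
  have "(\<Sum>j<k. (snd (d i) $ ix (Suc j)) *\<^sub>R d j) = (\<Sum>j<k. if j = i - 1 \<and> i \<noteq> 0 then d j else 0)"
    using assms(2) by (intro sum.cong) (auto simp: snd_d_nth)
  also have "\<dots> = (if i = 0 then 0 else d (i - 1))"
    using assms(2) by (cases i) auto
  finally show ?thesis
    using D_eqI[OF has_derivative_X[OF assms(1)]] by simp
qed

text \<open>Differentiate the identity \<open>D \<pi> q (X q) = 0\<close> in direction v and
  exchange the two derivatives of pi.\<close>

lemma X_D_pi:
  assumes "p \<in> U"
  shows "D (\<lambda>q. D \<pi> q v) p (X p) = - D \<pi> p (D X p v)"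
proof -
  have "((\<lambda>q. D \<pi> q (X q)) has_derivative (\<lambda>v. D (\<lambda>q. D \<pi> q (X p)) p v + D \<pi> p (D X p v))) (at p)"
    by (rule has_derivative_D_apply[OF open_U assms smooth_pi
          has_derivative_D[OF smooth_on_differentiable[OF smooth_X assms]]])
  moreover have "((\<lambda>q. D \<pi> q (X q)) has_derivative (\<lambda>v. 0)) (at p)"
    by (rule has_derivative_transform_within_open[OF has_derivative_const[of 0] open_U assms])
      (simp add: D_pi_X)
  ultimately have "(\<lambda>v. D (\<lambda>q. D \<pi> q (X p)) p v + D \<pi> p (D X p v)) = (\<lambda>v. 0)"
    using has_derivative_unique by blast
  then have "D (\<lambda>q. D \<pi> q (X p)) p v + D \<pi> p (D X p v) = 0"
    by metis
  then show ?thesis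
    using D_D_commute[OF open_U assms smooth_pi, of v "X p"] by (simp add: add_eq_0_iff2)
qed

lemma X_E:
  assumes "p \<in> U" "i \<le> k"
  shows "D (E i) p (X p) = - (if i = 0 then 0 else E (i - 1) p) - D F p (d i) *\<^sub>R E k p"
  using X_D_pi[OF assms(1), of "d i"] linear_D_pi[OF assms(1)]
  by (simp add: E_def[abs_def] D_X_d[OF assms] linear_add linear_scale linear_0)

text \<open>With w the sum of c_j E_j, the E_l-coefficient receives only the derivative of c_l and
  the term of E_{l+1}, whose derivative contains -E_l. The condition l < k discards the multiples of
  E_k produced by the derivatives of F.\<close>

lemma eps_X:
  assumes T: "open T" "T \<subseteq> U" and w: "smooth_on T w" and p: "p \<in> T" and l: "l < k"
  shows "eps l p (D w p (X p)) = D (\<lambda>q. eps l q (w q)) p (X p) - eps (Suc l) p (w p)"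
proof -
  have pU: "p \<in> U"
    using T p by auto
  define c where "c = (\<lambda>j q. eps j q (w q))"
  have dc: "c j differentiable at p" for j
    unfolding c_def by (rule smooth_on_differentiable[OF smooth_eps[OF T w] p])
  have "((\<lambda>q. \<Sum>j\<le>k. c j q *\<^sub>R E j q) has_derivative
      (\<lambda>v. \<Sum>j\<le>k. c j p *\<^sub>R D (E j) p v + D (c j) p v *\<^sub>R E j p)) (at p)"
    by (intro has_derivative_sum has_derivative_scaleR has_derivative_D dc smooth_on_differentiable[OF smooth_E pU])
  then have "(w has_derivative (\<lambda>v. \<Sum>j\<le>k. c j p *\<^sub>R D (E j) p v + D (c j) p v *\<^sub>R E j p)) (at p)"
    by (rule has_derivative_transform_within_open[OF _ T(1) p])
      (use T in \<open>auto simp: c_def coord_sum[OF frame_E]\<close>)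
  then have "eps l p (D w p (X p)) = (\<Sum>j\<le>k. c j p * eps l p (D (E j) p (X p)) + D (c j) p (X p) * eps l p (E j p))"
    by (simp add: D_eqI coord_simps)
  also have "\<dots> = (\<Sum>j\<le>k. (if j = Suc l then - c j p else 0) + (if j = l then D (c j) p (X p) else 0))"
    using l by (intro sum.cong) (auto simp: X_E[OF pU] coord_simps eps_E[OF pU])
  also have "\<dots> = D (c l) p (X p) - c (Suc l) p"
    using l by (simp add: sum.distrib)
  finally show ?thesis
    by (simp add: c_def)
qed

end

section \<open>The connection pulled back to the jet space\<close>

locale jet_connection = jet_quotient ix k F U \<pi> M
  for ix :: "nat \<Rightarrow> 'n::finite" and k :: nat and F :: "'n jet \<Rightarrow> real" and U :: "'n jet set"
    and \<pi> :: "'n jet \<Rightarrow> real^'n" and M :: "(real^'n) set" +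
  fixes \<Gamma> :: "real^'n \<Rightarrow> real^'n \<Rightarrow> real^'n \<Rightarrow> real^'n"
  assumes conn: "is_connection M \<Gamma>"
begin

lemma bilinear_Gam: "y \<in> M \<Longrightarrow> bilinear (\<Gamma> y)" and smooth_Gam: "smooth_on M (\<lambda>y. \<Gamma> y u v)"
  using conn by (auto simp: is_connection_def)

lemmas Gam_simps = bilinear_ladd[OF bilinear_Gam] bilinear_radd[OF bilinear_Gam] bilinear_lmul[OF bilinear_Gam]
  bilinear_rmul[OF bilinear_Gam] bilinear_lneg[OF bilinear_Gam] bilinear_rneg[OF bilinear_Gam]
  bilinear_lzero[OF bilinear_Gam] bilinear_rzero[OF bilinear_Gam]
  bilinear_lsub[OF bilinear_Gam] bilinear_rsub[OF bilinear_Gam]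

definition Rm :: "real^'n \<Rightarrow> real^'n \<Rightarrow> real^'n \<Rightarrow> real^'n \<Rightarrow> real^'n" where
  "Rm y a b c = curvature \<Gamma> (\<lambda>_. a) (\<lambda>_. b) (\<lambda>_. c) y"

lemma Rm_eq:
  assumes "y \<in> M"
  shows "Rm y a b c = D (\<lambda>y. \<Gamma> y b c) y a - D (\<lambda>y. \<Gamma> y a c) y b + \<Gamma> y a (\<Gamma> y b c) - \<Gamma> y b (\<Gamma> y a c)"
  by (simp add: Rm_def curvature_def cov_deriv_def[abs_def] lie_bracket_def Gam_simps[OF assms])

text \<open>Functions of jets with values in \<open>real^'n\<close> are read as sections of the
  tangent bundle of M pulled back along pi. The direction \<open>v\<close> is a constant vector
  field on the jet space, so two such directions commute.\<close>

definition nabla :: "'n jet \<Rightarrow> ('n jet \<Rightarrow> real^'n) \<Rightarrow> 'n jet \<Rightarrow> real^'n" where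
  "nabla v w p = D w p v + \<Gamma> (\<pi> p) (D \<pi> p v) (w p)"

lemma smooth_nabla:
  assumes "open T" "T \<subseteq> U" "smooth_on T w"
  shows "smooth_on T (nabla v w)"
  unfolding nabla_def[abs_def]
proof (rule smooth_on_add[OF assms(1) smooth_on_D[OF assms(3)]])
  show "smooth_on T (\<lambda>p. \<Gamma> (\<pi> p) (D \<pi> p v) (w p))"
    by (rule smooth_on_bilinear_param[OF assms(1) _ _ bilinear_Gam smooth_Gam
          smooth_on_D[OF smooth_on_subset[OF smooth_pi assms(2)]] assms(3)])
      (use pi_in_M assms(2) smooth_on_subset[OF smooth_pi] in auto)
qed

lemma nabla_add:
  "w differentiable at p \<Longrightarrow> z differentiable at p \<Longrightarrow> p \<in> U \<Longrightarrow>
    nabla v (\<lambda>q. w q + z q) p = nabla v w p + nabla v z p"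
  using D_eqI[OF has_derivative_add[OF has_derivative_D has_derivative_D, of w p z]]
  by (simp add: nabla_def Gam_simps pi_in_M)

lemma nabla_scaleR:
  "f differentiable at p \<Longrightarrow> w differentiable at p \<Longrightarrow> p \<in> U \<Longrightarrow>
    nabla v (\<lambda>q. f q *\<^sub>R w q) p = D f p v *\<^sub>R w p + f p *\<^sub>R nabla v w p"
  using D_eqI[OF has_derivative_scaleR[OF has_derivative_D has_derivative_D, of f p w]]
  by (simp add: nabla_def Gam_simps pi_in_M algebra_simps)

lemma nabla_uminus:
  "w differentiable at p \<Longrightarrow> p \<in> U \<Longrightarrow> nabla v (\<lambda>q. - w q) p = - nabla v w p"
  using D_eqI[OF has_derivative_minus[OF has_derivative_D, of w p]]
  by (simp add: nabla_def Gam_simps pi_in_M)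

lemma nabla_cong:
  assumes "open T" "p \<in> T" "\<And>q. q \<in> T \<Longrightarrow> w q = z q" "w differentiable at p"
  shows "nabla v z p = nabla v w p"
  using D_cong[OF assms] assms(2,3) by (simp add: nabla_def)

lemma D_nabla:
  assumes T: "open T" "T \<subseteq> U" and w: "smooth_on T w" and p: "p \<in> T"
  shows "D (nabla v w) p u = D (\<lambda>q. D w q v) p u + (D (\<lambda>y. \<Gamma> y (D \<pi> p v) (w p)) (\<pi> p) (D \<pi> p u)
    + \<Gamma> (\<pi> p) (D (\<lambda>q. D \<pi> q v) p u) (w p) + \<Gamma> (\<pi> p) (D \<pi> p v) (D w p u))"
proof -
  have pU: "p \<in> U" and im: "\<pi> ` U \<subseteq> M"
    using T p pi_in_M by auto
  have d: "w differentiable at p" "(\<lambda>q. D w q v) differentiable at p" "(\<lambda>q. D \<pi> q v) differentiable at p"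
    using smooth_on_differentiable[OF w p] smooth_on_differentiable[OF smooth_on_D[OF w] p]
      smooth_on_differentiable[OF smooth_on_D[OF smooth_pi] pU] by auto
  note h = has_derivative_bilinear_param[OF open_U pU im has_derivative_D[OF diff_pi[OF pU]]
      bilinear_Gam smooth_Gam has_derivative_D[OF d(3)] has_derivative_D[OF d(1)]]
  show ?thesis
    unfolding nabla_def[abs_def]
    by (rule D_eqI[OF has_derivative_add[OF has_derivative_D[OF d(2)] h]])
qed

text \<open>The second derivatives of w and of pi, and the terms with a first derivative of w,
  cancel in pairs. What is left are derivatives and products of Christoffel symbols, that is, the
  curvature; constant u and v produce no bracket term.\<close>

lemma curvature_nabla:
  assumes T: "open T" "T \<subseteq> U" and w: "smooth_on T w" and p: "p \<in> T"
  shows "nabla u (nabla v w) p - nabla v (nabla u w) p = Rm (\<pi> p) (D \<pi> p u) (D \<pi> p v) (w p)"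
proof -
  have pU: "p \<in> U"
    using T p by auto
  note y = pi_in_M[OF pU]
  have c: "D (\<lambda>q. D w q u) p v = D (\<lambda>q. D w q v) p u" "D (\<lambda>q. D \<pi> q u) p v = D (\<lambda>q. D \<pi> q v) p u"
    using D_D_commute[OF T(1) p w] D_D_commute[OF open_U pU smooth_pi] by auto
  show ?thesis
    unfolding nabla_def[of u "nabla v w"] nabla_def[of v "nabla u w"] D_nabla[OF assms]
    by (simp add: nabla_def c Rm_eq[OF y] Gam_simps[OF y])
qed

lemma linear_nabla:
  assumes "w differentiable at p" "p \<in> U"
  shows "linear (\<lambda>v. nabla v w p)"
  unfolding nabla_def using linear_D[OF assms(1)] linear_D_pi[OF assms(2)]
  by (intro linearI) (simp_all add: linear_add linear_scale Gam_simps pi_in_M[OF assms(2)] algebra_simps)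

text \<open>Commutation of nabla_v with the total derivative. Since
  \<open>D \<pi> p (X p) = 0\<close>, both the connection term along X and the curvature disappear;
  the only correction is the bracket of the constant field v with X, which is
  \<open>D X p v\<close>.\<close>

lemma X_nabla:
  assumes T: "open T" "T \<subseteq> U" and w: "smooth_on T w" and p: "p \<in> T"
  shows "D (nabla v w) p (X p) = nabla v (\<lambda>q. D w q (X q)) p - nabla (D X p v) w p"
proof -
  have pU: "p \<in> U"
    using T p by auto
  note y = pi_in_M[OF pU]
  have "linear (D (\<lambda>y. \<Gamma> y (D \<pi> p v) (w p)) (\<pi> p))"
    by (rule linear_D[OF smooth_on_differentiable[OF smooth_Gam y]])
  moreover have "D (\<lambda>q. D w q (X q)) p v = D (\<lambda>q. D w q (X p)) p v + D w p (D X p v)"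
    by (rule D_eqI[OF has_derivative_D_apply[OF T(1) p w
          has_derivative_D[OF smooth_on_differentiable[OF smooth_X pU]]]])
  ultimately show ?thesis
    unfolding D_nabla[OF assms] using D_D_commute[OF T(1) p w, of v "X p"]
    by (simp add: D_pi_X[OF pU] X_D_pi[OF pU] linear_0 nabla_def Gam_simps[OF y])
qed

end

section \<open>Propagation along the total derivative\<close>

context jet_connection
begin

lemma Rm_same: "y \<in> M \<Longrightarrow> Rm y a a c = 0"
  by (simp add: Rm_eq)

lemma linear_D_Gam:
  assumes "y \<in> M"
  shows "linear (\<lambda>a. D (\<lambda>y. \<Gamma> y a c) y v)" "linear (\<lambda>c. D (\<lambda>y. \<Gamma> y a c) y v)" "linear (D (\<lambda>y. \<Gamma> y a c) y)"
  using linear_param_D[OF open_M assms, of "\<lambda>y a. \<Gamma> y a c" v] linear_param_D[OF open_M assms, of "\<lambda>y c. \<Gamma> y a c" v]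
    bilinear_linear[OF bilinear_Gam] smooth_on_differentiable[OF smooth_Gam assms]
    linear_D[OF smooth_on_differentiable[OF smooth_Gam assms]] by auto

lemma linear_Rm:
  assumes "y \<in> M"
  shows "linear (\<lambda>a. Rm y a b c)" "linear (\<lambda>b. Rm y a b c)" "linear (\<lambda>c. Rm y a b c)"
  unfolding Rm_eq[OF assms]
  by (intro linearI; simp add: Gam_simps[OF assms] linear_add[OF linear_D_Gam(1)[OF assms]]
      linear_add[OF linear_D_Gam(2)[OF assms]] linear_add[OF linear_D_Gam(3)[OF assms]]
      linear_scale[OF linear_D_Gam(1)[OF assms]] linear_scale[OF linear_D_Gam(2)[OF assms]]
      linear_scale[OF linear_D_Gam(3)[OF assms]] algebra_simps)+

lemma ricci_eq: "ricci \<Gamma> y v w = trace (matrix (\<lambda>u. Rm y u v w))"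
  by (simp add: ricci_def Rm_def)

text \<open>Along the total derivative the dual frame is shifted, so the coefficient of $\nabla_v E_{i}$
  two or more places below $E_i$ is carried over to $\nabla_v E_{i-1}$.\<close>

lemma nabla_E_shift:
  assumes T: "open T" "T \<subseteq> U"
    and C: "\<And>p v l. p \<in> T \<Longrightarrow> l < k - 1 \<Longrightarrow> eps l p (nabla v (E k) p) = 0"
    and i: "1 \<le> i" "i \<le> k"
  shows "\<forall>p\<in>T. \<forall>v. (\<forall>l<i - 1. eps l p (nabla v (E i) p) = 0) \<and>
    eps (i - 1) p (nabla v (E i) p) = eps (k - 1) p (nabla v (E k) p)"
  \<comment> \<open>Downward induction starting from E_k, where the hypothesis \<open>C\<close> is
    the claim.\<close>
  using i(2,1)
proof (induction i rule: inc_induct)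
  case base
  then show ?case
    using C by auto
next
  case (step n)
  have A: "eps l p (nabla v (E (Suc n)) p) = 0" if "p \<in> T" "l < n" for l p v
    using step that by (simp del: split_paired_All)
  have B: "eps n p (nabla v (E (Suc n)) p) = eps (k - 1) p (nabla v (E k) p)" if "p \<in> T" for p v
    using step that by (simp del: split_paired_All)
  have key: "eps l p (nabla v (E n) p) = eps (Suc l) p (nabla v (E (Suc n)) p)"
    if p: "p \<in> T" and l: "l < n" for p v l
  proof -
    have pU: "p \<in> U"
      using p T by auto
    have smE: "smooth_on T (E j)" for j
      by (rule smooth_on_subset[OF smooth_E T(2)])
    have dE: "E j differentiable at p" for j
      by (rule smooth_on_differentiable[OF smE p])
    have dF: "(\<lambda>q. D F q (d (Suc n))) differentiable at p"
      by (rule smooth_on_differentiable[OF smooth_on_D[OF smooth_F] pU])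
    have lk: "l < k" "l < k - 1" "Suc n \<le> k"
      using l step by auto
    \<comment> \<open>\<open>A\<close> holds on all of the open set \<open>T\<close>, so the
      coefficient may be differentiated along X; its vanishing at the single jet p would not be
      enough.\<close>
    have "D (\<lambda>q. eps l q (nabla v (E (Suc n)) q)) p (X p) = 0"
    proof -
      have "((\<lambda>q. eps l q (nabla v (E (Suc n)) q)) has_derivative (\<lambda>v. 0)) (at p)"
        by (rule has_derivative_transform_within_open[OF has_derivative_const[of 0] T(1) p])
          (simp add: A[OF _ l])
      then show ?thesis
        by (rule D_eqI)
    qed
    then have "eps l p (D (nabla v (E (Suc n))) p (X p)) = - eps (Suc l) p (nabla v (E (Suc n)) p)"
      using eps_X[OF T smooth_nabla[OF T smE] p lk(1)] by simp
    moreover have "nabla v (\<lambda>q. D (E (Suc n)) q (X q)) p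
        = nabla v (\<lambda>q. - (E n q + D F q (d (Suc n)) *\<^sub>R E k q)) p"
    proof (rule nabla_cong[OF T(1) p, symmetric])
      fix q assume "q \<in> T"
      then show "D (E (Suc n)) q (X q) = - (E n q + D F q (d (Suc n)) *\<^sub>R E k q)"
        using X_E[of q "Suc n"] lk(3) T by (auto simp: algebra_simps)
    next
      show "(\<lambda>q. D (E (Suc n)) q (X q)) differentiable at p"
        by (rule smooth_on_differentiable[OF smooth_on_D_apply[OF T(1) smE smooth_on_subset[OF smooth_X T(2)]] p])
    qed
    moreover have "nabla v (\<lambda>q. - (E n q + D F q (d (Suc n)) *\<^sub>R E k q)) p
        = - (nabla v (E n) p + (D (\<lambda>q. D F q (d (Suc n))) p v *\<^sub>R E k p + D F p (d (Suc n)) *\<^sub>R nabla v (E k) p))"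
      by (simp only: nabla_uminus[OF differentiable_add[OF dE differentiable_scaleR[OF dF dE]] pU]
          nabla_add[OF dE differentiable_scaleR[OF dF dE] pU] nabla_scaleR[OF dF dE pU])
    ultimately have "eps l p (- (nabla v (E n) p + (D (\<lambda>q. D F q (d (Suc n))) p v *\<^sub>R E k p
        + D F p (d (Suc n)) *\<^sub>R nabla v (E k) p)) - nabla (D X p v) (E (Suc n)) p)
        = - eps (Suc l) p (nabla v (E (Suc n)) p)"
      using X_nabla[OF T smE p] by simp
    \<comment> \<open>The correction in direction \<open>D X p v\<close> is killed by
      \<open>A\<close>, because the induction covers every direction; the multiples of E_k and of
      its covariant derivative disappear since l < k - 1.\<close>
    then show ?thesis
      using A[OF p l] C[OF p lk(2)] eps_E[OF pU, of k l] lk by (simp add: coord_simps)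
  qed
  show ?case
  proof (intro ballI allI conjI impI)
    fix p v assume p: "p \<in> T"
    show "eps l p (nabla v (E n) p) = 0" if "l < n - 1" for l
      using key[OF p, of l v] A[OF p, of "Suc l" v] that by auto
    show "eps (n - 1) p (nabla v (E n) p) = eps (k - 1) p (nabla v (E k) p)"
      using key[OF p, of "n - 1" v] B[OF p, of v] step by auto
  qed
qed

text \<open>\<open>C\<close> is the paraconformal condition in the frame of the E_i, and
  \<open>tg\<close> the vanishing of the symmetric part of the second fundamental form of the
  projected slices. Both are required on an open set, since their consequences are differentiated
  once more in the curvature.\<close>

theorem ricci_E_k:
  assumes T: "open T" "T \<subseteq> U"
    and C: "\<And>p v l. p \<in> T \<Longrightarrow> l < k - 1 \<Longrightarrow> eps l p (nabla v (E k) p) = 0"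
    and tg: "\<And>p i j. p \<in> T \<Longrightarrow> i \<in> {1..k} \<Longrightarrow> j \<in> {1..k} \<Longrightarrow>
      eps 0 p (nabla (d i) (E j) p) + eps 0 p (nabla (d j) (E i) p) = 0"
    and p: "p \<in> T"
  shows "ricci \<Gamma> (\<pi> p) (E k p) (E k p) = 0"
proof -
  have TU: "q \<in> U" if "q \<in> T" for q
    using that T by auto
  have smE: "smooth_on T (E j)" for j
    by (rule smooth_on_subset[OF smooth_E T(2)])
  have dE: "E j differentiable at q" if "q \<in> T" for j q
    by (rule smooth_on_differentiable[OF smE that])
  \<comment> \<open>The index 0 lies below i - 1 for i >= 2 and equals i - 1 for i = 1; so among
    E_1, ..., E_k only E_1 has an E_0-coefficient that carries beta.\<close>
  have high: "eps 0 q (nabla v (E i) q) = 0" if "q \<in> T" "2 \<le> i" "i \<le> k" for q v i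
    using nabla_E_shift[OF T C, of i] that by (simp del: split_paired_All)
  have one: "eps 0 q (nabla v (E 1) q) = eps (k - 1) q (nabla v (E k) q)" if "q \<in> T" for q v
    using nabla_E_shift[OF T C, of 1] that k2 by (simp del: split_paired_All)
  \<comment> \<open>For j >= 2 the partner nabla_{d_1} E_j has no E_0-coefficient by
    \<open>high\<close>, so the symmetrised condition determines the other term alone; for j = 1 the
    two terms coincide.\<close>
  have beta: "eps (k - 1) q (nabla (d j) (E k) q) = 0" if q: "q \<in> T" and j: "j \<in> {1..k}" for q j
  proof (cases "j = 1")
    case True
    then show ?thesis
      using tg[OF q, of 1 1] one[OF q, of "d 1"] k2 by simp
  next
    case False
    then show ?thesis
      using tg[OF q, of j 1] one[OF q, of "d j"] high[OF q, of j "d 1"] j k2 by simp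
  qed
  have II: "eps 0 q (nabla (d j) (E i) q) = 0" if "q \<in> T" "i \<in> {1..k}" "j \<in> {1..k}" for q i j
    using one[of q "d j"] beta[of q j] high[of q i "d j"] that by (cases "i = 1") auto
  define \<alpha> where "\<alpha> = (\<lambda>j q. eps k q (nabla (d j) (E k) q))"
  define \<beta> where "\<beta> = (\<lambda>q. eps (k - 1) q (nabla (d 0) (E k) q))"
  have da: "\<alpha> j differentiable at q" and db: "\<beta> differentiable at q" if "q \<in> T" for j q
    unfolding \<alpha>_def \<beta>_def
    by (rule smooth_on_differentiable[OF smooth_eps[OF T smooth_nabla[OF T smE]] that])+
  \<comment> \<open>The line of E_k is parallel along the slices; among the d_j only d_0 can still
    turn it towards E_{k-1}, as \<open>par0\<close> records.\<close>
  have par: "nabla (d j) (E k) q = \<alpha> j q *\<^sub>R E k q" if q: "q \<in> T" and j: "j \<in> {1..k}" for q j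
  proof (rule coord_eqI[OF frame_E[OF TU[OF q]]])
    fix l assume l: "l \<le> k"
    consider "l < k - 1" | "l = k - 1" | "l = k"
      using l by linarith
    then show "eps l q (nabla (d j) (E k) q) = eps l q (\<alpha> j q *\<^sub>R E k q)"
      using C[OF q] beta[OF q j] eps_E[OF TU[OF q], of k l] l k2
      by cases (auto simp: coord_simps \<alpha>_def)
  qed
  have par0: "nabla (d 0) (E k) q = \<alpha> 0 q *\<^sub>R E k q + \<beta> q *\<^sub>R E (k - 1) q" if q: "q \<in> T" for q
  proof (rule coord_eqI[OF frame_E[OF TU[OF q]]])
    fix l assume l: "l \<le> k"
    consider "l < k - 1" | "l = k - 1" | "l = k"
      using l by linarith
    then show "eps l q (nabla (d 0) (E k) q) = eps l q (\<alpha> 0 q *\<^sub>R E k q + \<beta> q *\<^sub>R E (k - 1) q)"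
      using C[OF q] eps_E[OF TU[OF q], of k l] eps_E[OF TU[OF q], of "k - 1" l] l k2
      by cases (auto simp: coord_simps \<alpha>_def \<beta>_def)
  qed
  note pU = TU[OF p]
  \<comment> \<open>\<open>par\<close> holds throughout \<open>T\<close>, so both sides can be
    differentiated in any direction v, including d_0.\<close>
  have nn: "nabla v (nabla (d j) (E k)) p = D (\<alpha> j) p v *\<^sub>R E k p + \<alpha> j p *\<^sub>R nabla v (E k) p"
    if j: "j \<in> {1..k}" for j v
  proof -
    have "nabla v (nabla (d j) (E k)) p = nabla v (\<lambda>q. \<alpha> j q *\<^sub>R E k q) p"
      by (rule nabla_cong[OF T(1) p]) (use par j differentiable_scaleR[OF da[OF p] dE[OF p]] in auto)
    then show ?thesis
      using nabla_scaleR[OF da[OF p] dE[OF p] pU] by simp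
  qed
  have nn0: "nabla v (nabla (d 0) (E k)) p = (D (\<alpha> 0) p v *\<^sub>R E k p + \<alpha> 0 p *\<^sub>R nabla v (E k) p)
      + (D \<beta> p v *\<^sub>R E (k - 1) p + \<beta> p *\<^sub>R nabla v (E (k - 1)) p)" for v
  proof -
    have "nabla v (nabla (d 0) (E k)) p = nabla v (\<lambda>q. \<alpha> 0 q *\<^sub>R E k q + \<beta> q *\<^sub>R E (k - 1) q) p"
      by (rule nabla_cong[OF T(1) p])
        (use par0 differentiable_add[OF differentiable_scaleR[OF da[OF p] dE[OF p]]
            differentiable_scaleR[OF db[OF p] dE[OF p]]] in auto)
    then show ?thesis
      by (simp only: nabla_add[OF differentiable_scaleR[OF da[OF p] dE[OF p]]
            differentiable_scaleR[OF db[OF p] dE[OF p]] pU] nabla_scaleR[OF da[OF p] dE[OF p] pU]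
          nabla_scaleR[OF db[OF p] dE[OF p] pU])
  qed
  \<comment> \<open>The trace is computed in the frame of the E_i; each diagonal entry vanishes on
    its own.\<close>
  have "eps i p (Rm (\<pi> p) (E i p) (E k p) (E k p)) = 0" if i: "i \<le> k" for i
  proof -
    have R: "Rm (\<pi> p) (E i p) (E k p) (E k p) = nabla (d i) (nabla (d k) (E k)) p - nabla (d k) (nabla (d i) (E k)) p"
      using curvature_nabla[OF T smE p, of "d i" "d k" k] by (simp add: E_def)
    have kk: "k \<in> {1..k}" "k - 1 \<in> {1..k}" "0 < k - 1"
      using k2 by auto
    consider "i = k" | "i \<in> {1..k}" "i < k" | "i = 0"
      using i by fastforce
    then show ?thesis
    proof cases
      case 1
      then show ?thesis
        by (simp add: Rm_same[OF pi_in_M[OF pU]] coord_simps)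
    next
      \<comment> \<open>Both second derivatives are multiples of E_k, and i < k.\<close>
      case 2
      then show ?thesis
        unfolding R nn[OF kk(1)] nn[OF 2(1)] using par[OF p] kk(1)
        by (simp add: coord_simps eps_E[OF pU])
    next
      \<comment> \<open>The E_0-coefficient of nabla_{d_0} E_k vanishes by \<open>C\<close>, since 0
        < k - 1. The other terms are derivatives of E_k and E_{k-1} along d_k, where
        \<open>II\<close> applies because k - 1 >= 1.\<close>
      case 3
      show ?thesis
        unfolding R unfolding 3 nn[OF kk(1)] nn0
        using C[OF p kk(3)] II[OF p kk(1) kk(1)] II[OF p kk(2) kk(1)] eps_E[OF pU, of k 0] eps_E[OF pU, of "k - 1" 0] kk
        by (simp add: coord_simps)
    qed
  qed
  then show ?thesis
    unfolding ricci_eq trace_coord[OF frame_E[OF pU] linear_Rm(1)[OF pi_in_M[OF pU]]] by simp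
qed

end

section \<open>The null direction\<close>

lemma in_span_pair: "x \<in> span {a, b} \<longleftrightarrow> (\<exists>r s. x = r *\<^sub>R a + s *\<^sub>R (b :: 'a::real_vector))"
proof -
  have "x \<in> span {a, b} \<longleftrightarrow> (\<exists>r s. x - r *\<^sub>R a = s *\<^sub>R b)"
    by (auto simp: span_breakdown_eq span_singleton)
  also have "\<dots> \<longleftrightarrow> (\<exists>r s. x = r *\<^sub>R a + s *\<^sub>R b)"
    by (simp add: diff_eq_eq add.commute)
  finally show ?thesis .
qed

lemma vector_derivative_rnc_point:
  "vector_derivative (rnc_point k b) (at s) = (\<Sum>i\<le>k. (real i * s ^ (i - 1)) *\<^sub>R b i)"
proof (rule vector_derivative_at)
  have "((\<lambda>s. \<Sum>i\<le>k. s ^ i *\<^sub>R b i) has_vector_derivative (\<Sum>i\<le>k. (real i * s ^ (i - 1)) *\<^sub>R b i)) (at s)"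
  proof (rule has_vector_derivative_sum)
    fix i
    have "((\<lambda>s. s ^ i) has_vector_derivative (real i * s ^ (i - 1))) (at s)"
      using DERIV_pow[of i s] by (simp add: has_real_derivative_iff_has_vector_derivative)
    then show "((\<lambda>s. s ^ i *\<^sub>R b i) has_vector_derivative (real i * s ^ (i - 1)) *\<^sub>R b i) (at s)"
      using has_vector_derivative_scaleR[OF _ has_vector_derivative_const, of "\<lambda>s. s ^ i" _ s UNIV "b i"]
      by (simp add: has_real_derivative_iff_has_vector_derivative)
  qed
  then show "(rnc_point k b has_vector_derivative (\<Sum>i\<le>k. (real i * s ^ (i - 1)) *\<^sub>R b i)) (at s)"
    by (simp add: rnc_point_def[abs_def])
qed

lemma (in index_bij) coord_rnc_point:
  "frame b \<Longrightarrow> i \<le> k \<Longrightarrow> coord b (rnc_point k b s) i = s ^ i"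
  by (rule coord_unique) (auto simp: rnc_point_def)

text \<open>On the line at infinity coordinate 0 vanishes, as k >= 1. Any other cone vector is c
  times a curve point and has coordinates c and c s in places 0 and 1, from which c and s are read
  off.\<close>

lemma (in index_bij) rnc_cone_affine_point:
  assumes "frame b" "k \<ge> 1" "w \<in> rnc_cone k b" "coord b w 0 \<noteq> 0"
  shows "w = coord b w 0 *\<^sub>R rnc_point k b (coord b w 1 / coord b w 0)"
proof -
  have "coord b (c *\<^sub>R b k) 0 = 0" for c
    using assms(1,2) by (simp add: coord_simps coord_basis)
  then obtain c s where w: "w = c *\<^sub>R rnc_point k b s"
    using assms(3,4) by (auto simp: rnc_cone_def)
  then have "coord b w 0 = c" "coord b w 1 = c * s"
    using assms(1,2) by (simp_all add: coord_simps coord_rnc_point)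
  then show ?thesis
    using w assms(4) by simp
qed

section \<open>The null direction as a moving point of the curve\<close>

locale paraconformal_patch = jet_connection ix k F U \<pi> M \<Gamma>
  for ix :: "nat \<Rightarrow> 'n::finite" and k :: nat and F :: "'n jet \<Rightarrow> real" and U :: "'n jet set"
    and \<pi> :: "'n jet \<Rightarrow> real^'n" and M :: "(real^'n) set"
    and \<Gamma> :: "real^'n \<Rightarrow> real^'n \<Rightarrow> real^'n \<Rightarrow> real^'n" +
  fixes W :: "(real^'n) set" and V :: "nat \<Rightarrow> real^'n \<Rightarrow> real^'n"
  assumes W: "open W" "W \<subseteq> M" and pf: "paraconformal_frame ix k U \<pi> W V"
    and cov: "\<And>Y s z. smooth_on W Y \<Longrightarrow> z \<in> W \<Longrightarrow> cov_deriv \<Gamma> Y (\<lambda>z. rnc_point k (\<lambda>i. V i z) s) z \<in>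
              span {rnc_point k (\<lambda>i. V i z) s, vector_derivative (rnc_point k (\<lambda>i. V i z)) (at s)}"
begin

abbreviation rnc :: "real^'n \<Rightarrow> real \<Rightarrow> real^'n" where
  "rnc z \<equiv> rnc_point k (\<lambda>i. V i z)"

abbreviation vc :: "nat \<Rightarrow> 'n jet \<Rightarrow> real" where
  "vc i q \<equiv> coord (\<lambda>i. V i (\<pi> q)) (E k q) i"

definition T0 :: "'n jet set" where
  "T0 = U \<inter> \<pi> -` W"

text \<open>Jets over \<open>W\<close> whose null line is not the point at infinity of the curve. On
  this open set the parameter \<open>\<sigma>\<close> of the line is a smooth function.\<close>

definition T1 :: "'n jet set" where
  "T1 = {q \<in> T0. vc 0 q \<noteq> 0}"

definition \<sigma> :: "'n jet \<Rightarrow> real" where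
  "\<sigma> q = vc 1 q / vc 0 q"

lemma frame_V: "z \<in> W \<Longrightarrow> frame (\<lambda>i. V i z)"
  using pf is_basis_frame by (simp add: paraconformal_frame_def)

lemma smooth_V: "i \<le> k \<Longrightarrow> smooth_on W (V i)"
  using pf by (simp add: paraconformal_frame_def)

lemma open_T0: "open T0"
  unfolding T0_def using continuous_open_preimage[OF smooth_on_continuous[OF smooth_pi] open_U W(1)] .

lemma smooth_vc: "smooth_on T0 (vc i)"
proof (rule smooth_on_coord[OF open_T0])
  show "smooth_on T0 (\<lambda>q. V i (\<pi> q))" if "i \<le> k" for i
    by (rule smooth_on_compose[OF open_T0 smooth_on_subset[OF smooth_pi] smooth_V[OF that]]) (auto simp: T0_def)
  show "frame (\<lambda>i. V i (\<pi> q))" if "q \<in> T0" for q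
    using that frame_V by (auto simp: T0_def)
  show "smooth_on T0 (E k)"
    by (rule smooth_on_subset[OF smooth_E]) (auto simp: T0_def)
qed

lemma open_T1: "open T1"
proof -
  have "T1 = T0 \<inter> vc 0 -` (- {0})"
    by (auto simp: T1_def)
  then show ?thesis
    using continuous_open_preimage[OF smooth_on_continuous[OF smooth_vc] open_T0, of "- {0}" 0] by auto
qed

lemma T1_subset: "T1 \<subseteq> T0" "T1 \<subseteq> U" "q \<in> T1 \<Longrightarrow> \<pi> q \<in> W"
  by (auto simp: T1_def T0_def)

lemma smooth_sigma: "smooth_on T1 \<sigma>"
  unfolding \<sigma>_def[abs_def]
  by (rule smooth_on_divide[OF open_T1 smooth_on_subset[OF smooth_vc T1_subset(1)] smooth_on_subset[OF smooth_vc T1_subset(1)]])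
    (simp add: T1_def)

lemma E_k_in_cone:
  assumes "q \<in> T0"
  shows "E k q \<in> rnc_cone k (\<lambda>i. V i (\<pi> q))"
proof -
  have q: "q \<in> U" "\<pi> q \<in> W"
    using assms by (auto simp: T0_def)
  have eq: "null_cone ix k U \<pi> (\<pi> q) = rnc_cone k (\<lambda>i. V i (\<pi> q))"
    using pf q by (simp add: paraconformal_frame_def)
  \<comment> \<open>The zero vector is a null vector, which yields a cone admissible in
    \<open>null_cone\<close>; every admissible cone contains \<open>E k q\<close>, since q lies in
    the fibre.\<close>
  have "0 *\<^sub>R V k (\<pi> q) \<in> null_cone ix k U \<pi> (\<pi> q)"
    unfolding eq rnc_cone_def by blast
  then have "E k q \<in> null_cone ix k U \<pi> (\<pi> q)"
    unfolding null_cone_def E_def using q(1) by blast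
  then show ?thesis
    using eq by simp
qed

lemma E_k_eq:
  assumes "q \<in> T1"
  shows "E k q = vc 0 q *\<^sub>R rnc (\<pi> q) (\<sigma> q)"
  unfolding \<sigma>_def using rnc_cone_affine_point[OF frame_V _ E_k_in_cone] T1_subset assms k2
  by (auto simp: T1_def)

text \<open>The paraconformal condition concerns fixed s, while E_k equals m V(sigma) with sigma
  depending on the jet. Differentiating m adds a multiple of V, differentiating sigma a multiple of
  V', and both stay in the span.\<close>

lemma nabla_E_k_span:
  assumes p: "p \<in> T1"
  shows "nabla v (E k) p \<in> span {rnc (\<pi> p) (\<sigma> p), vector_derivative (rnc (\<pi> p)) (at (\<sigma> p))}"
proof -
  define m where "m = vc 0"
  have pU: "p \<in> U" and pW: "\<pi> p \<in> W"
    using p T1_subset by auto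
  note y = pi_in_M[OF pU]
  have Ek: "E k q = m q *\<^sub>R rnc (\<pi> q) (\<sigma> q)" if "q \<in> T1" for q
    using E_k_eq[OF that] by (simp only: m_def)
  have pT0: "p \<in> T0"
    using p T1_subset by auto
  have m: "(m has_derivative D m p) (at p)"
    unfolding m_def by (rule has_derivative_D[OF smooth_on_differentiable[OF smooth_vc pT0]])
  have s: "(\<sigma> has_derivative D \<sigma> p) (at p)"
    by (rule has_derivative_D[OF smooth_on_differentiable[OF smooth_sigma p]])
  have dV: "V i differentiable at (\<pi> p)" if "i \<le> k" for i
    by (rule smooth_on_differentiable[OF smooth_V[OF that] pW])
  have c: "((\<lambda>q. m q * \<sigma> q ^ i) has_derivative
      (\<lambda>v. m p * (real i * D \<sigma> p v * \<sigma> p ^ (i - 1)) + D m p v * \<sigma> p ^ i)) (at p)" for i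
    by (rule has_derivative_mult[OF m has_derivative_power[OF s]])
  have "((\<lambda>q. \<Sum>i\<le>k. (m q * \<sigma> q ^ i) *\<^sub>R V i (\<pi> q)) has_derivative
      (\<lambda>v. \<Sum>i\<le>k. (m p * \<sigma> p ^ i) *\<^sub>R D (V i) (\<pi> p) (D \<pi> p v)
        + (m p * (real i * D \<sigma> p v * \<sigma> p ^ (i - 1)) + D m p v * \<sigma> p ^ i) *\<^sub>R V i (\<pi> p))) (at p)"
    by (intro has_derivative_sum has_derivative_scaleR[OF c] has_derivative_compose[OF has_derivative_D[OF diff_pi[OF pU]]]
        has_derivative_D dV) auto
  then have "(E k has_derivative
      (\<lambda>v. \<Sum>i\<le>k. (m p * \<sigma> p ^ i) *\<^sub>R D (V i) (\<pi> p) (D \<pi> p v)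
        + (m p * (real i * D \<sigma> p v * \<sigma> p ^ (i - 1)) + D m p v * \<sigma> p ^ i) *\<^sub>R V i (\<pi> p))) (at p)"
    by (rule has_derivative_transform_within_open[OF _ open_T1 p])
      (simp add: Ek rnc_point_def scaleR_sum_right)
  note DE = D_eqI[OF this]
  define a where "a = D \<pi> p v"
  have rs: "D (\<lambda>z. rnc z t) (\<pi> p) a = (\<Sum>i\<le>k. t ^ i *\<^sub>R D (V i) (\<pi> p) a)" for t
    unfolding rnc_point_def
    by (rule D_eqI) (auto intro!: has_derivative_sum has_derivative_scaleR_right has_derivative_D dV)
  have lin: "linear (\<Gamma> (\<pi> p) a)"
    using bilinear_linear(1)[OF bilinear_Gam[OF y]] .
  \<comment> \<open>In the covariant derivative the parameter is frozen at its value at p; its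
    variation is collected in the last term.\<close>
  have "nabla v (E k) p = m p *\<^sub>R cov_deriv \<Gamma> (\<lambda>_. a) (\<lambda>z. rnc z (\<sigma> p)) (\<pi> p)
      + (D m p v *\<^sub>R rnc (\<pi> p) (\<sigma> p) + (m p * D \<sigma> p v) *\<^sub>R vector_derivative (rnc (\<pi> p)) (at (\<sigma> p)))"
    unfolding nabla_def cov_deriv_def DE rs a_def[symmetric] Ek[OF p]
      vector_derivative_rnc_point linear_scale[OF lin]
    by (simp add: rnc_point_def sum.distrib scaleR_sum_right algebra_simps)
  then show ?thesis
    using cov[OF smooth_on_const pW, of a "\<sigma> p"]
    by (auto intro!: span_add span_scale intro: span_base)
qed

text \<open>The span of V and V' is identified by testing it on the direction \<open>X p\<close>,
  where nabla E_k is -E_{k-1} minus a multiple of E_k. Hence V' has no E_l-coefficient for l < k -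
  1, and neither has any nabla_v E_k.\<close>

lemma eps_nabla_E_k:
  assumes p: "p \<in> T1" and l: "l < k - 1"
  shows "eps l p (nabla v (E k) p) = 0"
proof -
  let ?V = "rnc (\<pi> p) (\<sigma> p)" and ?V' = "vector_derivative (rnc (\<pi> p)) (at (\<sigma> p))"
  have pU: "p \<in> U" 
    using p T1_subset by auto
  have nz: "vc 0 p \<noteq> 0"
    using p by (simp add: T1_def)
  have *: "vc 0 p * eps j p ?V = eps j p (E k p)" for j
    using arg_cong[OF E_k_eq[OF p], of "eps j p"] by (simp only: coord_simps real_scaleR_def)
  have V: "eps j p ?V = 0" if "j < k" for j
  proof -
    have "eps j p (E k p) = 0"
      using that eps_E[OF pU, of k j] by simp
    then show ?thesis
      using *[of j] nz by (metis mult_eq_0_iff)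
  qed
  have "nabla (X p) (E k) p = - E (k - 1) p - D F p (d k) *\<^sub>R E k p"
    unfolding nabla_def using k2 by (simp add: X_E[OF pU] D_pi_X[OF pU] Gam_simps pi_in_M[OF pU])
  then obtain r s where rs: "- E (k - 1) p - D F p (d k) *\<^sub>R E k p = r *\<^sub>R ?V + s *\<^sub>R ?V'"
    using nabla_E_k_span[OF p, of "X p"] unfolding in_span_pair by auto
  have e: "- (if j = k - 1 then 1 else 0) = s * eps j p ?V'" if "j < k" for j
    using arg_cong[OF rs, of "eps j p"] that V[OF that] eps_E[OF pU, of k j] eps_E[OF pU, of "k - 1" j]
    by (simp add: coord_simps split: if_splits)
  \<comment> \<open>The E_{k-1}-coefficient reads -1 = s times that of V', so V' really occurs in
    the decomposition.\<close>
  have "s \<noteq> 0"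
    using e[of "k - 1"] k2 by auto
  then have "eps l p ?V' = 0"
    using e[of l] l by auto
  moreover obtain r' s' where "nabla v (E k) p = r' *\<^sub>R ?V + s' *\<^sub>R ?V'"
    using nabla_E_k_span[OF p, of v] unfolding in_span_pair by auto
  ultimately show ?thesis
    using V[of l] l by (simp add: coord_simps)
qed

end

section \<open>Geodesics and slices\<close>

lemma smooth_on_Pair:
  assumes "open S" "smooth_on S f" "smooth_on S g"
  shows "smooth_on S (\<lambda>x. (f x, g x))"
proof -
  have "bounded_linear (\<lambda>a. (a, 0))" "bounded_linear (\<lambda>b. (0, b))"
    by (intro bounded_linear_Pair bounded_linear_ident bounded_linear_zero)+
  then have "smooth_on S (\<lambda>x. (f x, 0) + (0, g x))"
    using smooth_on_add[OF assms(1) smooth_on_bounded_linear[OF assms(1) _ assms(2)]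
        smooth_on_bounded_linear[OF assms(1) _ assms(3)]] by blast
  then show ?thesis
    by simp
qed

text \<open>Geodesics are the projections of integral curves of the geodesic spray, a first-order
  field on pairs of position in M and velocity.\<close>

lemma geodesic_exists:
  fixes \<Gamma> :: "'a::euclidean_space \<Rightarrow> 'a \<Rightarrow> 'a \<Rightarrow> 'a"
  assumes M: "open M" "y \<in> M" and conn: "is_connection M \<Gamma>"
  obtains e \<gamma> \<gamma>' where "e > 0" "geodesic M \<Gamma> e \<gamma> \<gamma>'" "\<gamma> 0 = y" "\<gamma>' 0 = v"
proof -
  define f where "f = (\<lambda>z::'a \<times> 'a. (snd z, - \<Gamma> (fst z) (snd z) (snd z)))"
  have op: "open (M \<times> (UNIV :: 'a set))"
    by (intro open_Times M open_UNIV)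
  have fs: "smooth_on (M \<times> (UNIV :: 'a set)) fst" "smooth_on (M \<times> (UNIV :: 'a set)) snd"
    using smooth_on_bounded_linear[OF op bounded_linear_fst smooth_on_ident[OF op]]
      smooth_on_bounded_linear[OF op bounded_linear_snd smooth_on_ident[OF op]] by auto
  have bil: "\<And>y. y \<in> M \<Longrightarrow> bilinear (\<Gamma> y)" and sm: "\<And>u v. smooth_on M (\<lambda>y. \<Gamma> y u v)"
    using conn by (auto simp: is_connection_def)
  have "smooth_on (M \<times> UNIV) (\<lambda>z. \<Gamma> (fst z) (snd z) (snd z))"
    by (rule smooth_on_bilinear_param[OF op _ fs(1) bil sm fs(2) fs(2)]) auto
  then have "smooth_on (M \<times> UNIV) f"
    unfolding f_def by (intro smooth_on_Pair[OF op] smooth_on_minus[OF op] fs)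
  then obtain e c where e: "e > 0" and c0: "c 0 = (y, v)"
    and c: "\<And>t. t \<in> {-e<..<e} \<Longrightarrow> c t \<in> M \<times> UNIV \<and> (c has_vector_derivative f (c t)) (at t)"
    using picard_lindelof_local[OF op, of "(y, v)" f] M(2) by (metis SigmaI UNIV_I)
  have "geodesic M \<Gamma> e (\<lambda>t. fst (c t)) (\<lambda>t. snd (c t))"
    unfolding geodesic_def
  proof
    fix t assume t: "t \<in> {-e<..<e}"
    show "fst (c t) \<in> M \<and> ((\<lambda>t. fst (c t)) has_vector_derivative snd (c t)) (at t) \<and>
        ((\<lambda>t. snd (c t)) has_vector_derivative - \<Gamma> (fst (c t)) (snd (c t)) (snd (c t))) (at t)"
      using c[OF t] bounded_linear.has_vector_derivative[OF bounded_linear_fst conjunct2[OF c[OF t]]]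
        bounded_linear.has_vector_derivative[OF bounded_linear_snd conjunct2[OF c[OF t]]]
      by (auto simp: f_def)
  qed
  then show ?thesis
    using that[OF e, of "\<lambda>t. fst (c t)" "\<lambda>t. snd (c t)"] c0 by simp
qed

text \<open>Split v into a part in S and a vector b orthogonal to S. The inner product of c with b
  is constant on I, so its derivative, the squared length of b, vanishes.\<close>

lemma has_vector_derivative_in_subspace:
  fixes c :: "real \<Rightarrow> 'a::euclidean_space"
  assumes c: "(c has_vector_derivative v) (at t)" and S: "subspace S" and I: "open I" "t \<in> I"
    and dS: "\<And>s. s \<in> I \<Longrightarrow> c s - c t \<in> S"
  shows "v \<in> S"
proof -
  obtain a b where ab: "a \<in> span S" "\<And>w. w \<in> span S \<Longrightarrow> orthogonal b w" "v = a + b"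
    using orthogonal_subspace_decomp_exists[of S v] by metis
  have "((\<lambda>s. c s \<bullet> b) has_vector_derivative v \<bullet> b) (at t)"
    by (rule bounded_linear.has_vector_derivative[OF bounded_linear_inner_left c])
  moreover have "((\<lambda>s. c s \<bullet> b) has_vector_derivative 0) (at t)"
  proof (rule has_vector_derivative_transform_within_open[OF has_vector_derivative_const I])
    fix s assume "s \<in> I"
    then have "orthogonal b (c s - c t)"
      using ab(2) dS by (simp add: span_base)
    then show "c t \<bullet> b = c s \<bullet> b"
      by (simp add: orthogonal_def inner_diff_right inner_commute)
  qed
  ultimately have "v \<bullet> b = 0"
    by (rule vector_derivative_unique_at)
  moreover have "a \<bullet> b = 0"
    using ab(1,2) by (simp add: orthogonal_def inner_commute)
  ultimately have "b = 0"
    using ab(3) by (simp add: inner_add_left)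
  then show ?thesis
    using ab(1,3) S by (metis add.right_neutral span_eq_iff)
qed

section \<open>Leaves of the distribution D_k and their projections\<close>

context jet_quotient
begin

text \<open>The distribution D_k is constant in jet coordinates; this is its value at every jet, cut
  out by dt = dx_0 = 0.\<close>

definition jet_hyperplane :: "'n jet set" where
  "jet_hyperplane = {v. fst v = 0 \<and> snd v $ ix 0 = 0}"

lemma jet_hyperplane_eq_span: "jet_hyperplane = span (d ` {1..k})"
proof
  show "jet_hyperplane \<subseteq> span (d ` {1..k})"
  proof
    fix v assume v: "v \<in> jet_hyperplane"
    have "v = fst v *\<^sub>R jet_t + (\<Sum>i\<le>k. (snd v $ ix i) *\<^sub>R d i)"
      by (rule jet_decomp)
    also have "\<dots> = (\<Sum>i\<le>k. (snd v $ ix i) *\<^sub>R d i)"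
      using v by (simp add: jet_hyperplane_def)
    also have "\<dots> \<in> span (d ` {1..k})"
    proof (rule span_sum)
      fix i assume "i \<in> {..k}"
      then show "(snd v $ ix i) *\<^sub>R d i \<in> span (d ` {1..k})"
        using v by (cases "i = 0") (auto simp: jet_hyperplane_def span_zero intro!: span_scale intro: span_base)
    qed
    finally show "v \<in> span (d ` {1..k})" .
  qed
  have sub: "subspace jet_hyperplane"
    by (auto simp: jet_hyperplane_def subspace_def)
  show "span (d ` {1..k}) \<subseteq> jet_hyperplane"
  proof (rule span_minimal[OF _ sub], rule image_subsetI)
    fix i assume "i \<in> {1..k}"
    then show "d i \<in> jet_hyperplane"
      using snd_d_nth[of i 0] by (simp add: jet_hyperplane_def) (simp add: jet_partial_def)
  qed
qed

lemma subspace_jet_hyperplane: "subspace jet_hyperplane"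
  unfolding jet_hyperplane_eq_span by (rule subspace_span)

lemma dim_jet_hyperplane: "dim jet_hyperplane = k"
proof -
  have "d ` {1..k} \<subseteq> Basis"
    by (auto simp: jet_partial_def Basis_prod_def axis_in_Basis_iff)
  then have "independent (d ` {1..k})"
    using independent_Basis independent_mono by blast
  moreover have "inj_on d {1..k}"
    by (auto simp: inj_on_def jet_partial_def axis_eq_axis ix_eq_iff)
  ultimately show ?thesis
    unfolding jet_hyperplane_eq_span by (simp add: dim_span_eq_card_independent card_image del: dim_span)
qed

text \<open>A piece of the leaf of D_k through p, the affine subspace where t and x_0 are fixed, cut
  off by a ball so that it can be placed inside \<open>U\<close>.\<close>

definition slice :: "'n jet \<Rightarrow> real \<Rightarrow> 'n jet set" where
  "slice p r = {q. fst q = fst p \<and> snd q \<in> ball (snd p) r \<and> snd q $ ix 0 = snd p $ ix 0}"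

lemma slice_diff: "q \<in> slice p r \<Longrightarrow> q' \<in> slice p r \<Longrightarrow> q' - q \<in> jet_hyperplane"
  by (auto simp: slice_def jet_hyperplane_def)

lemma slice_line:
  assumes "q \<in> slice p r" "v \<in> jet_hyperplane"
  obtains e where "e > 0" "\<And>s. s \<in> {-e<..<e} \<Longrightarrow> q + s *\<^sub>R v \<in> slice p r"
proof -
  define A where "A = (\<lambda>s. snd q + s *\<^sub>R snd v) -` ball (snd p) r"
  have "open A"
    unfolding A_def by (rule open_vimage[OF open_ball]) (intro continuous_intros)
  moreover have "0 \<in> A"
    using assms by (simp add: A_def slice_def)
  ultimately obtain e where e: "e > 0" "ball 0 e \<subseteq> A"
    using open_contains_ball by blast
  show ?thesis
  proof
    show "e > 0"
      by fact
    fix s assume "s \<in> {-e<..<e}"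
    then have "s \<in> A"
      using e(2) by (auto simp: subset_iff dist_real_def)
    then show "q + s *\<^sub>R v \<in> slice p r"
      using assms by (auto simp: A_def slice_def jet_hyperplane_def)
  qed
qed

lemma smooth_on_line: "open I \<Longrightarrow> smooth_on I (\<lambda>s. q + s *\<^sub>R (v :: 'a::real_normed_vector))"
  by (intro smooth_on_add smooth_on_const smooth_on_bounded_linear[OF _ bounded_linear_scaleR_left] smooth_on_ident)

lemma tangent_space_slice:
  assumes q: "q \<in> slice p r"
  shows "tangent_space (slice p r) q = jet_hyperplane"
proof
  show "tangent_space (slice p r) q \<subseteq> jet_hyperplane"
  proof
    fix v assume "v \<in> tangent_space (slice p r) q"
    then obtain e c where e: "e > 0" and c: "c ` {-e<..<e} \<subseteq> slice p r" "c 0 = q" "(c has_vector_derivative v) (at 0)"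
      by (auto simp: tangent_space_def)
    have "c s - c 0 \<in> jet_hyperplane" if "s \<in> {-e<..<e}" for s
      using slice_diff[OF q, of "c s"] c(1,2) that by blast
    then show "v \<in> jet_hyperplane"
      by (intro has_vector_derivative_in_subspace[OF c(3) subspace_jet_hyperplane, of "{-e<..<e}"])
        (use e in auto)
  qed
  show "jet_hyperplane \<subseteq> tangent_space (slice p r) q"
  proof
    fix v assume "v \<in> jet_hyperplane"
    then obtain e where e: "e > 0" "\<And>s. s \<in> {-e<..<e} \<Longrightarrow> q + s *\<^sub>R v \<in> slice p r"
      using slice_line[OF q] by blast
    have "((\<lambda>s. q + s *\<^sub>R v) has_vector_derivative v) (at 0)"
      by (auto intro!: derivative_eq_intros)
    then show "v \<in> tangent_space (slice p r) q"
      unfolding tangent_space_def using e smooth_on_line[of "{-e<..<e}" q v]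
      by (intro CollectI exI[of _ e] conjI exI[of _ "\<lambda>s. q + s *\<^sub>R v"]) auto
  qed
qed

lemma integral_manifold_slice: "integral_manifold k (\<lambda>p. span (jet_partial ix ` {1..k})) (slice p r)"
  unfolding integral_manifold_def
proof (intro conjI ballI)
  have "convex (slice p r)"
  proof (rule convexI)
    fix q q' and u v :: real
    assume qq: "q \<in> slice p r" "q' \<in> slice p r" and uv: "0 \<le> u" "0 \<le> v" "u + v = 1"
    have "u *\<^sub>R snd q + v *\<^sub>R snd q' \<in> ball (snd p) r"
      by (rule convexD[OF convex_ball _ _ uv]) (use qq in \<open>simp_all only: slice_def mem_Collect_eq\<close>)
    moreover have "u * c + v * c = c" for c
      using uv by (metis distrib_right mult_1)
    ultimately show "u *\<^sub>R q + v *\<^sub>R q' \<in> slice p r"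
      using qq by (auto simp: slice_def)
  qed
  then show "connected (slice p r)"
    by (rule convex_connected)
  show "tangent_space (slice p r) q = span (d ` {1..k})" if "q \<in> slice p r" for q
    using tangent_space_slice[OF that] jet_hyperplane_eq_span by simp
  show "embedded_submanifold k (slice p r)"
    unfolding embedded_submanifold_def
  proof
    fix q assume q: "q \<in> slice p r"
    \<comment> \<open>The slice is flat, so translating q to 0 is a chart; \<open>W\<close> may be
      unbounded in t because the equations of the slice fix t.\<close>
    define W where "W = (UNIV :: real set) \<times> ball (snd p) r"
    have W: "open W" "open ((\<lambda>x. x - q) ` W)"
      unfolding W_def by (intro open_translation_subtract open_Times open_UNIV open_ball)+
    show "\<exists>W \<phi> \<psi> S. open W \<and> q \<in> W \<and> open (\<phi> ` W) \<and> smooth_on W \<phi> \<and> smooth_on (\<phi> ` W) \<psi> \<and>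
       (\<forall>x\<in>W. \<psi> (\<phi> x) = x) \<and> subspace (S :: 'n jet set) \<and> dim S = k \<and> \<phi> ` (slice p r \<inter> W) = S \<inter> \<phi> ` W"
    proof (intro exI conjI)
      show "q \<in> W"
        using q by (auto simp: W_def slice_def mem_Times_iff)
      show "smooth_on W (\<lambda>x. x - q)"
        by (intro smooth_on_diff smooth_on_ident smooth_on_const W)
      show "smooth_on ((\<lambda>x. x - q) ` W) (\<lambda>x. x + q)"
        by (intro smooth_on_add smooth_on_ident smooth_on_const W)
      show "(\<lambda>x. x - q) ` (slice p r \<inter> W) = jet_hyperplane \<inter> (\<lambda>x. x - q) ` W"
        using q by (auto simp: W_def slice_def jet_hyperplane_def mem_Times_iff)
    qed (use W subspace_jet_hyperplane dim_jet_hyperplane in auto)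
  qed
qed

end

lemma (in index_bij) vec_ix_eqI: "(\<And>i. i \<le> k \<Longrightarrow> x $ ix i = y $ ix i) \<Longrightarrow> x = (y :: real^'n)"
  unfolding vec_eq_iff by (metis ix_cases)

context jet_quotient
begin

lemma tangent_space_pi_slice:
  assumes sub: "slice p r \<subseteq> U" and q: "q \<in> slice p r" and v: "v \<in> jet_hyperplane"
  shows "D \<pi> q v \<in> tangent_space (\<pi> ` slice p r) (\<pi> q)"
proof -
  obtain e where e: "e > 0" "\<And>s. s \<in> {-e<..<e} \<Longrightarrow> q + s *\<^sub>R v \<in> slice p r"
    using slice_line[OF q v] by blast
  have "smooth_on {-e<..<e} (\<lambda>s. \<pi> (q + s *\<^sub>R v))"
    by (rule smooth_on_compose[OF open_greaterThanLessThan smooth_on_line[OF open_greaterThanLessThan] smooth_pi])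
      (use e(2) sub in auto)
  moreover have "((\<lambda>s. \<pi> (q + s *\<^sub>R v)) has_vector_derivative D \<pi> q v) (at 0)"
  proof -
    have qU: "q \<in> U"
      using q sub by auto
    have "((\<lambda>s. q + s *\<^sub>R v) has_derivative (\<lambda>s. s *\<^sub>R v)) (at 0)"
      by (auto intro!: derivative_eq_intros)
    moreover have "(\<pi> has_derivative D \<pi> q) (at (q + 0 *\<^sub>R v))"
      using has_derivative_D[OF diff_pi[OF qU]] by simp
    ultimately have "((\<lambda>s. \<pi> (q + s *\<^sub>R v)) has_derivative (\<lambda>s. D \<pi> q (s *\<^sub>R v))) (at 0)"
      by (rule has_derivative_compose)
    then show ?thesis
      unfolding has_vector_derivative_def linear_scale[OF linear_D_pi[OF qU]] .
  qed
  ultimately show ?thesis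
    unfolding tangent_space_def using e
    by (intro CollectI exI[of _ e] conjI exI[of _ "\<lambda>s. \<pi> (q + s *\<^sub>R v)"]) auto
qed

text \<open>For fixed t the projection is a local diffeomorphism, because its partial derivatives
  are the E_i. It serves to lift curves in M to curves of jets with constant t.\<close>

definition restr :: "real \<Rightarrow> real^'n \<Rightarrow> real^'n" where
  "restr t x = \<pi> (t, x)"

lemma has_derivative_restr:
  assumes "(t, x) \<in> U"
  shows "(restr t has_derivative (\<lambda>h. \<Sum>i\<le>k. (h $ ix i) *\<^sub>R E i (t, x))) (at x)"
proof -
  have "((\<lambda>x. (t, x)) has_derivative (\<lambda>h. (0, h))) (at x)"
    by (auto intro!: derivative_eq_intros)
  from has_derivative_compose[OF this has_derivative_D[OF diff_pi[OF assms]]]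
  have "(restr t has_derivative (\<lambda>h. D \<pi> (t, x) (0, h))) (at x)"
    by (simp add: restr_def[abs_def])
  then show ?thesis
    using D_pi_vertical[OF assms] by simp
qed

lemma restr_local_inverse:
  assumes "(t, x0) \<in> U"
  obtains U' V g g' where "open U'" "x0 \<in> U'" "\<And>x. x \<in> U' \<Longrightarrow> (t, x) \<in> U" "open V"
    "homeomorphism U' V (restr t) g" "\<And>y. y \<in> V \<Longrightarrow> (g has_derivative (g' y)) (at y)"
proof -
  define P' where "P' = (\<lambda>x. Blinfun (\<lambda>h. \<Sum>i\<le>k. (h $ ix i) *\<^sub>R E i (t, x)))"
  \<comment> \<open>The inverse of the differential at x0: it sends w to the vector whose entries
    are the coframe coordinates of w.\<close>
  define Q where "Q = Blinfun (\<lambda>w. \<Sum>i\<le>k. eps i (t, x0) w *\<^sub>R axis (ix i) (1::real))"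
  define O' where "O' = (\<lambda>x. (t, x)) -` U"
  have bl: "bounded_linear (\<lambda>h. \<Sum>i\<le>k. (h $ ix i) *\<^sub>R E i (t, x))" for x
    by (intro bounded_linear_sum bounded_linear_scaleR_const bounded_linear_vec_nth)
  have P': "blinfun_apply (P' x) = (\<lambda>h. \<Sum>i\<le>k. (h $ ix i) *\<^sub>R E i (t, x))" for x
    unfolding P'_def by (rule bounded_linear_Blinfun_apply[OF bl])
  have "bounded_linear (\<lambda>w. \<Sum>i\<le>k. eps i (t, x0) w *\<^sub>R axis (ix i) (1::real))"
    by (intro bounded_linear_sum bounded_linear_scaleR_const linear_conv_bounded_linear[THEN iffD1] linear_coord)
  then have Q: "blinfun_apply Q = (\<lambda>w. \<Sum>i\<le>k. eps i (t, x0) w *\<^sub>R axis (ix i) 1)"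
    unfolding Q_def by (rule bounded_linear_Blinfun_apply)
  have "Q o\<^sub>L P' x0 = id_blinfun"
  proof (rule blinfun_eqI)
    fix h :: "real^'n"
    have "eps i (t, x0) (\<Sum>j\<le>k. (h $ ix j) *\<^sub>R E j (t, x0)) = h $ ix i" if "i \<le> k" for i
      by (rule coord_unique[OF frame_E[OF assms] refl that])
    then have "blinfun_apply Q (blinfun_apply (P' x0) h) = (\<Sum>i\<le>k. h $ ix i *\<^sub>R axis (ix i) 1)"
      by (simp add: P' Q)
    also have "\<dots> = h"
      using sum_axis[of h] by (simp add: sum_ix)
    finally show "blinfun_apply (Q o\<^sub>L P' x0) h = blinfun_apply id_blinfun h"
      by simp
  qed
  moreover have "open O'"
    unfolding O'_def by (rule open_vimage[OF open_U]) (intro continuous_intros)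
  moreover have "continuous_on O' P'"
  proof (rule continuous_on_blinfun_componentwise)
    have cE: "continuous_on O' (\<lambda>x. E i (t, x))" for i
      by (rule continuous_on_compose2[OF smooth_on_continuous[OF smooth_E]])
        (auto simp: O'_def intro!: continuous_intros)
    show "continuous_on O' (\<lambda>x. blinfun_apply (P' x) b)" for b
      unfolding P' by (intro continuous_intros cE)
  qed
  moreover have "(restr t has_derivative blinfun_apply (P' x)) (at x)" if "x \<in> O'" for x
    unfolding P' using has_derivative_restr that by (simp add: O'_def)
  moreover have "x0 \<in> O'"
    using assms by (simp add: O'_def)
  ultimately obtain U' V g g' where "open U'" "U' \<subseteq> O'" "x0 \<in> U'" "open V" "homeomorphism U' V (restr t) g"
    "\<And>y. y \<in> V \<Longrightarrow> (g has_derivative (g' y)) (at y)"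
    using inverse_function_theorem[of O' "restr t" P' x0 Q] by metis
  then show ?thesis
    using that[of U' V g g'] by (auto simp: O'_def)
qed

end

section \<open>Second fundamental form of the projected leaves\<close>

context jet_connection
begin

text \<open>A geodesic tangent to the projected slice lifts to the slice, so the slice coordinate
  \<open>x\<^sub>0\<close> of its velocity vanishes identically; differentiating this once gives the statement.\<close>

lemma geodesic_eps:
  assumes tg: "totally_geodesic_connection ix k U \<pi> M \<Gamma>" and p: "p \<in> U" and v: "v \<in> jet_hyperplane"
  shows "eps 0 p (nabla v (\<lambda>q. D \<pi> q v) p) = 0"
proof -
  define t where "t = fst p"
  define x0 where "x0 = snd p"
  have tx: "p = (t, x0)"
    by (simp add: t_def x0_def)
  obtain U' V g g' where U': "open U'" "x0 \<in> U'" "\<And>x. x \<in> U' \<Longrightarrow> (t, x) \<in> U" and V: "open V"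
    and hom: "homeomorphism U' V (restr t) g" and g: "\<And>y. y \<in> V \<Longrightarrow> (g has_derivative (g' y)) (at y)"
    using restr_local_inverse[OF p[unfolded tx]] by blast
  \<comment> \<open>The ball is taken inside the domain on which \<open>restr t\<close> is
    injective, so the local inverse \<open>g\<close> sends a point of the projected slice back to
    the slice.\<close>
  obtain r where r: "r > 0" "ball x0 r \<subseteq> U'"
    using U' open_contains_ball by blast
  have sl: "slice p r \<subseteq> U"
  proof
    fix q assume "q \<in> slice p r"
    then have "snd q \<in> U'" "q = (t, snd q)"
      using r(2) by (auto simp: slice_def t_def x0_def prod_eq_iff)
    then show "q \<in> U"
      using U'(3) by metis
  qed
  have pS: "p \<in> slice p r"
    using r by (simp add: slice_def)
  obtain e \<gamma> \<gamma>' where e: "e > 0" and geo: "geodesic M \<Gamma> e \<gamma> \<gamma>'" and \<gamma>0: "\<gamma> 0 = \<pi> p" "\<gamma>' 0 = D \<pi> p v"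
    using geodesic_exists[OF open_M pi_in_M[OF p] conn] by blast
  have tgN: "totally_geodesic M \<Gamma> (\<pi> ` slice p r)"
    using tg sl integral_manifold_slice by (simp add: totally_geodesic_connection_def)
  have "geodesic M \<Gamma> e \<gamma> \<gamma>' \<and> \<gamma> 0 \<in> \<pi> ` slice p r \<and> \<gamma>' 0 \<in> tangent_space (\<pi> ` slice p r) (\<gamma> 0)"
    using geo \<gamma>0 tangent_space_pi_slice[OF sl pS v] pS by simp
  then have "\<forall>\<^sub>F \<tau> in nhds 0. \<gamma> \<tau> \<in> \<pi> ` slice p r"
    using tgN[unfolded totally_geodesic_def] e by blast
  then obtain dl where dl: "dl > 0" "\<And>\<tau>. \<bar>\<tau>\<bar> < dl \<Longrightarrow> \<gamma> \<tau> \<in> \<pi> ` slice p r"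
    unfolding eventually_nhds_metric by (auto simp: dist_real_def)
  define I where "I = {- min e dl <..< min e dl}"
  have I: "open I" "0 \<in> I"
    using e dl by (auto simp: I_def)
  have \<gamma>': "(\<gamma> has_vector_derivative \<gamma>' \<tau>) (at \<tau>)"
    and \<gamma>'': "(\<gamma>' has_vector_derivative - \<Gamma> (\<gamma> \<tau>) (\<gamma>' \<tau>) (\<gamma>' \<tau>)) (at \<tau>)" if "\<tau> \<in> I" for \<tau>
    using geo that by (auto simp: geodesic_def I_def)
  define \<xi> where "\<xi> = (\<lambda>\<tau>. g (\<gamma> \<tau>))"
  have lift: "\<gamma> \<tau> \<in> V \<and> \<xi> \<tau> \<in> U' \<and> restr t (\<xi> \<tau>) = \<gamma> \<tau> \<and> \<xi> \<tau> $ ix 0 = x0 $ ix 0" if "\<tau> \<in> I" for \<tau>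
  proof -
    have "\<bar>\<tau>\<bar> < dl"
      using that by (auto simp: I_def)
    then obtain q where q: "q \<in> slice p r" "\<gamma> \<tau> = \<pi> q"
      using dl by blast
    then have "snd q \<in> U'" "q = (t, snd q)" "snd q $ ix 0 = x0 $ ix 0"
      using r(2) by (auto simp: slice_def t_def x0_def prod_eq_iff)
    then have "snd q \<in> U'" "\<gamma> \<tau> = restr t (snd q)" "snd q $ ix 0 = x0 $ ix 0"
      using q(2) by (metis restr_def)+
    then show ?thesis
      using hom by (auto simp: \<xi>_def homeomorphism_def)
  qed
  define \<xi>' where "\<xi>' = (\<lambda>\<tau>. g' (\<gamma> \<tau>) (\<gamma>' \<tau>))"
  have d\<xi>: "(\<xi> has_vector_derivative \<xi>' \<tau>) (at \<tau>)" if "\<tau> \<in> I" for \<tau>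
    unfolding \<xi>_def \<xi>'_def
    using vector_derivative_diff_chain_within[OF \<gamma>'[OF that] has_derivative_at_withinI[OF g]] lift[OF that] by (simp add: o_def)
  have \<xi>U: "(t, \<xi> \<tau>) \<in> U" if "\<tau> \<in> I" for \<tau>
    using lift[OF that] U'(3) by auto
  have vel: "\<gamma>' \<tau> = (\<Sum>i\<le>k. (\<xi>' \<tau> $ ix i) *\<^sub>R E i (t, \<xi> \<tau>))" if "\<tau> \<in> I" for \<tau>
  proof (rule vector_derivative_unique_at[OF \<gamma>'[OF that]])
    have "((restr t \<circ> \<xi>) has_vector_derivative (\<Sum>i\<le>k. (\<xi>' \<tau> $ ix i) *\<^sub>R E i (t, \<xi> \<tau>))) (at \<tau>)"
      by (rule vector_derivative_diff_chain_within[OF d\<xi>[OF that] has_derivative_at_withinI[OF has_derivative_restr[OF \<xi>U[OF that]]]])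
    then show "(\<gamma> has_vector_derivative (\<Sum>i\<le>k. (\<xi>' \<tau> $ ix i) *\<^sub>R E i (t, \<xi> \<tau>))) (at \<tau>)"
      by (rule has_vector_derivative_transform_within_open[OF _ I(1) that]) (use lift in auto)
  qed
  have \<xi>'0: "\<xi>' \<tau> $ ix 0 = 0" if "\<tau> \<in> I" for \<tau>
  proof (rule vector_derivative_unique_at)
    show "((\<lambda>\<tau>. \<xi> \<tau> $ ix 0) has_vector_derivative \<xi>' \<tau> $ ix 0) (at \<tau>)"
      by (rule bounded_linear.has_vector_derivative[OF bounded_linear_vec_nth d\<xi>[OF that]])
    show "((\<lambda>\<tau>. \<xi> \<tau> $ ix 0) has_vector_derivative 0) (at \<tau>)"
      by (rule has_vector_derivative_transform_within_open[OF has_vector_derivative_const[of "x0 $ ix 0"] I(1) that])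
        (use lift in auto)
  qed
  have eps\<gamma>: "eps 0 (t, \<xi> \<tau>) (\<gamma>' \<tau>) = 0" if "\<tau> \<in> I" for \<tau>
    using coord_unique[OF frame_E[OF \<xi>U[OF that]] vel[OF that], of 0] \<xi>'0[OF that] by simp
  have start: "\<xi> 0 = x0"
    using hom U'(2) \<gamma>0 tx by (auto simp: \<xi>_def homeomorphism_def restr_def)
  have v0: "v = (0, snd v)" "snd v $ ix 0 = 0"
    using v by (simp_all add: jet_hyperplane_def prod_eq_iff)
  \<comment> \<open>The lift starts with velocity v, so derivatives along it at time 0 become
    derivatives at p in direction v.\<close>
  have "\<xi>' 0 = snd v"
  proof (rule vec_ix_eqI)
    fix i assume i: "i \<le> k"
    have "eps i p (\<gamma>' 0) = \<xi>' 0 $ ix i"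
      using coord_unique[OF frame_E[OF p] _ i] vel[OF I(2)] start tx by auto
    moreover have "eps i p (D \<pi> p v) = snd v $ ix i"
      using coord_unique[OF frame_E[OF p] _ i] D_pi_vertical[OF p, of v] v0 by (metis fst_conv)
    ultimately show "\<xi>' 0 $ ix i = snd v $ ix i"
      using \<gamma>0 by simp
  qed
  with d\<xi>[OF I(2)] have d\<xi>0: "(\<xi> has_derivative (\<lambda>s. s *\<^sub>R snd v)) (at 0)"
    by (simp add: has_vector_derivative_def)
  have deps: "(\<lambda>q. eps 0 q c) differentiable at p" for c
    by (rule smooth_on_differentiable[OF smooth_eps[OF open_U order_refl smooth_on_const] p])
  define w where "w = D \<pi> p v"
  have A1: "((\<lambda>q. eps 0 q (D \<pi> q v)) has_derivative
      (\<lambda>u. D (\<lambda>q. eps 0 q w) p u + eps 0 p (D (\<lambda>q. D \<pi> q v) p u))) (at p)"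
    unfolding w_def
    by (rule has_derivative_linear_param[OF open_U p linear_coord deps
          has_derivative_D[OF smooth_on_differentiable[OF smooth_on_D[OF smooth_pi] p]]])
  have A2: "((\<lambda>q. eps 0 q (D \<pi> q v)) has_derivative (\<lambda>u. 0)) (at p)"
  proof (rule has_derivative_transform_within_open[OF has_derivative_const[of 0] open_U p])
    fix q assume q: "q \<in> U"
    show "0 = eps 0 q (D \<pi> q v)"
      using coord_unique[OF frame_E[OF q] D_pi_vertical[OF q], of v 0] v0 by (metis fst_conv le0)
  qed
  \<comment> \<open>First of two equations containing the derivative of the coframe on the fixed
    vector w: the E_0-coefficient of \<open>D \<pi> q v\<close> is the x_0-entry of v, which is zero
    at every jet.\<close>
  have A: "D (\<lambda>q. eps 0 q w) p v + eps 0 p (D (\<lambda>q. D \<pi> q v) p v) = 0"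
    by (rule fun_cong[OF has_derivative_unique[OF A1 A2]])
  have chain: "((\<lambda>\<tau>. eps 0 (t, \<xi> \<tau>) c) has_derivative (\<lambda>s. D (\<lambda>q. eps 0 q c) p (s *\<^sub>R v))) (at 0)" for c
  proof -
    have "((\<lambda>\<tau>. (t, \<xi> \<tau>)) has_derivative (\<lambda>s. (0, s *\<^sub>R snd v))) (at 0)"
      by (intro has_derivative_Pair has_derivative_const d\<xi>0)
    moreover have "(0, s *\<^sub>R snd v) = s *\<^sub>R v" for s
      using v0(1) by (metis scaleR_Pair scaleR_zero_right)
    ultimately have "((\<lambda>\<tau>. (t, \<xi> \<tau>)) has_derivative (\<lambda>s. s *\<^sub>R v)) (at 0)"
      by simp
    moreover have "((\<lambda>q. eps 0 q c) has_derivative D (\<lambda>q. eps 0 q c) p) (at (t, \<xi> 0))"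
      using has_derivative_D[OF deps] by (simp add: start tx[symmetric])
    ultimately show ?thesis
      by (rule has_derivative_compose)
  qed
  have B1: "((\<lambda>\<tau>. eps 0 (t, \<xi> \<tau>) (\<gamma>' \<tau>)) has_derivative
      (\<lambda>u. D (\<lambda>\<tau>. eps 0 (t, \<xi> \<tau>) (\<gamma>' 0)) 0 u + eps 0 (t, \<xi> 0) (u *\<^sub>R (- \<Gamma> (\<gamma> 0) (\<gamma>' 0) (\<gamma>' 0))))) (at 0)"
    by (rule has_derivative_linear_param[OF I linear_coord])
      (use differentiableI[OF chain] \<gamma>''[OF I(2)] in \<open>auto simp: has_vector_derivative_def\<close>)
  have B2: "((\<lambda>\<tau>. eps 0 (t, \<xi> \<tau>) (\<gamma>' \<tau>)) has_derivative (\<lambda>u. 0)) (at 0)"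
    by (rule has_derivative_transform_within_open[OF has_derivative_const[of 0] I]) (use eps\<gamma> in auto)
  have "D (\<lambda>\<tau>. eps 0 (t, \<xi> \<tau>) (\<gamma>' 0)) 0 1 + eps 0 (t, \<xi> 0) (1 *\<^sub>R (- \<Gamma> (\<gamma> 0) (\<gamma>' 0) (\<gamma>' 0))) = 0"
    by (rule fun_cong[OF has_derivative_unique[OF B1 B2]])
  \<comment> \<open>Second equation, from the velocity of the geodesic, whose acceleration is
    -Gamma(w, w). Eliminating the derivative of the coframe between \<open>A\<close> and
    \<open>B\<close> leaves the claim.\<close>
  then have B: "D (\<lambda>q. eps 0 q w) p v + eps 0 p (- \<Gamma> (\<pi> p) w w) = 0"
    using D_eqI[OF chain, of w 1] by (simp add: \<gamma>0 w_def start tx[symmetric])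
  show ?thesis
    using A B unfolding nabla_def w_def[symmetric] by (simp add: coord_simps)
qed

text \<open>Polarisation of \<open>geodesic_eps\<close> over d_i, d_j and d_i + d_j; quadratic
  information of this kind yields only the symmetric part.\<close>

theorem totally_geodesic_eps:
  assumes tg: "totally_geodesic_connection ix k U \<pi> M \<Gamma>" and p: "p \<in> U" and ij: "i \<in> {1..k}" "j \<in> {1..k}"
  shows "eps 0 p (nabla (d i) (E j) p) + eps 0 p (nabla (d j) (E i) p) = 0"
proof -
  have S: "d i \<in> jet_hyperplane" "d j \<in> jet_hyperplane"
    unfolding jet_hyperplane_eq_span using ij by (auto intro: span_base)
  then have S2: "d i + d j \<in> jet_hyperplane"
    using subspace_jet_hyperplane subspace_add by blast
  have dE: "E m differentiable at p" for m
    by (rule smooth_on_differentiable[OF smooth_E p])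
  have "nabla (d i + d j) (\<lambda>q. D \<pi> q (d i + d j)) p = nabla (d i + d j) (\<lambda>q. E i q + E j q) p"
  proof (rule nabla_cong[OF open_U p])
    show "(\<lambda>q. E i q + E j q) differentiable at p"
      by (rule differentiable_add[OF dE dE])
  qed (simp add: E_def linear_add[OF linear_D_pi])
  also have "\<dots> = nabla (d i) (E i) p + nabla (d j) (E i) p + (nabla (d i) (E j) p + nabla (d j) (E j) p)"
    by (simp add: nabla_add[OF dE dE p] linear_add[OF linear_nabla[OF dE p]])
  finally have eq: "nabla (d i + d j) (\<lambda>q. D \<pi> q (d i + d j)) p
      = nabla (d i) (E i) p + nabla (d j) (E i) p + (nabla (d i) (E j) p + nabla (d j) (E j) p)" .
  have "eps 0 p (nabla (d i) (E i) p) = 0" "eps 0 p (nabla (d j) (E j) p) = 0"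
    using geodesic_eps[OF tg p S(1)] geodesic_eps[OF tg p S(2)] by (simp_all add: E_def[abs_def])
  then show ?thesis
    using geodesic_eps[OF tg p S2] unfolding eq by (simp add: coord_simps)
qed

end

section \<open>The Ricci tensor on the null cone\<close>

context jet_connection
begin

lemma ricci_sum: "ricci \<Gamma> y v w = (\<Sum>j\<in>UNIV. Rm y (axis j 1) v w $ j)"
  by (simp add: ricci_eq trace_def matrix_def)

lemma linear_ricci:
  assumes "y \<in> M"
  shows "linear (\<lambda>v. ricci \<Gamma> y v w)" "linear (\<lambda>w. ricci \<Gamma> y v w)"
  unfolding ricci_sum
  by (intro linearI; simp add: linear_add[OF linear_Rm(2)[OF assms]] linear_add[OF linear_Rm(3)[OF assms]]
      linear_scale[OF linear_Rm(2)[OF assms]] linear_scale[OF linear_Rm(3)[OF assms]] sum.distrib sum_distrib_left)+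

lemma ricci_scaleR: "y \<in> M \<Longrightarrow> ricci \<Gamma> y (c *\<^sub>R v) (c *\<^sub>R v) = c\<^sup>2 * ricci \<Gamma> y v v"
  by (simp add: linear_scale[OF linear_ricci(1)] linear_scale[OF linear_ricci(2)] power2_eq_square)

lemma smooth_ricci: "smooth_on M (\<lambda>y. ricci \<Gamma> y v w)"
proof (rule smooth_on_cong[OF open_M])
  have G: "smooth_on M (\<lambda>y. \<Gamma> y a (\<Gamma> y b c))" for a b c
    by (rule smooth_on_linear_param[OF open_M bilinear_linear(1)[OF bilinear_Gam] smooth_Gam smooth_Gam])
  show "smooth_on M (\<lambda>y. \<Sum>j\<in>UNIV. (D (\<lambda>y. \<Gamma> y v w) y (axis j 1) - D (\<lambda>y. \<Gamma> y (axis j 1) w) y v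
      + \<Gamma> y (axis j 1) (\<Gamma> y v w) - \<Gamma> y v (\<Gamma> y (axis j 1) w)) $ j)"
    by (intro smooth_on_sum[OF open_M] smooth_on_vec_nth[OF open_M] smooth_on_diff[OF open_M] smooth_on_add[OF open_M]
        smooth_on_D smooth_Gam G)
qed (simp add: ricci_sum Rm_eq)

text \<open>An integral curve of X through a preimage of y; pi is constant along it because
  \<open>D \<pi>\<close> kills X.\<close>

lemma fibre_curve:
  assumes "y \<in> M"
  obtains e c where "e > 0" "\<And>t. t \<in> {-e<..<e} \<Longrightarrow> c t \<in> U \<and> \<pi> (c t) = y \<and> (c has_vector_derivative X (c t)) (at t)"
proof -
  obtain p where p: "p \<in> U" "\<pi> p = y"
    using pi_image assms by auto
  obtain e c where e: "e > 0" and c0: "c 0 = p"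
    and c: "\<And>t. t \<in> {-e<..<e} \<Longrightarrow> c t \<in> U \<and> (c has_vector_derivative X (c t)) (at t)"
    using picard_lindelof_local[OF open_U p(1) smooth_X] by metis
  have "((\<pi> \<circ> c) has_vector_derivative 0) (at t within {-e<..<e})" if t: "t \<in> {-e<..<e}" for t
  proof -
    have "(c has_vector_derivative X (c t)) (at t within {-e<..<e})"
      using c[OF t] has_vector_derivative_at_within by blast
    from vector_derivative_diff_chain_within[OF this has_derivative_at_withinI[OF has_derivative_D[OF diff_pi]]]
    show ?thesis
      using c[OF t] D_pi_X by simp
  qed
  then obtain z where z: "\<And>t. t \<in> {-e<..<e} \<Longrightarrow> (\<pi> \<circ> c) t = z"
    using has_vector_derivative_zero_constant[OF convex_real_interval(8), of "-e" e "\<pi> \<circ> c"] by blast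
  have "z = y"
    using z[of 0] e c0 p(2) by simp
  then have "c t \<in> U \<and> \<pi> (c t) = y \<and> (c has_vector_derivative X (c t)) (at t)" if "t \<in> {-e<..<e}" for t
    using z[OF that] c[OF that] by simp
  then show ?thesis
    using that[of e c] e by blast
qed

text \<open>If E_k kept a constant direction along an integral curve of X, its derivative would be a
  multiple of E_k; but that derivative has E_{k-1}-coefficient -1.\<close>

lemma E_k_not_in_line:
  assumes J: "open J" "t \<in> J"
    and c: "\<And>t. t \<in> J \<Longrightarrow> c t \<in> U \<and> (c has_vector_derivative X (c t)) (at t)"
    and line: "\<And>t. t \<in> J \<Longrightarrow> E k (c t) \<in> span {w}"
  shows False
proof -
  note cU = conjunct1[OF c[OF J(2)]] and dc = conjunct2[OF c[OF J(2)]]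
  have "((E k \<circ> c) has_vector_derivative D (E k) (c t) (X (c t))) (at t)"
    by (rule vector_derivative_diff_chain_within[OF dc has_derivative_at_withinI[OF has_derivative_D[OF smooth_on_differentiable[OF smooth_E cU]]]])
  moreover have "(E k \<circ> c) s - (E k \<circ> c) t \<in> span {w}" if "s \<in> J" for s
    using span_diff[OF line[OF that] line[OF J(2)]] by simp
  ultimately have "D (E k) (c t) (X (c t)) \<in> span {w}"
    using has_vector_derivative_in_subspace[OF _ subspace_span J] by blast
  then obtain b where b: "D (E k) (c t) (X (c t)) = b *\<^sub>R w"
    by (auto simp: span_singleton)
  obtain a where a: "E k (c t) = a *\<^sub>R w"
    using line[OF J(2)] by (auto simp: span_singleton)
  have "a \<noteq> 0"
    using E_nonzero[OF cU, of k] a by auto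
  have eq: "a *\<^sub>R D (E k) (c t) (X (c t)) = b *\<^sub>R E k (c t)"
    by (simp add: a b)
  have "k - Suc 0 \<noteq> k"
    using k2 by auto
  then have "a * (- 1) = 0"
    using arg_cong[OF eq, of "eps (k - 1) (c t)"] k2
    by (simp add: X_E[OF cU] coord_simps eps_E[OF cU])
  with \<open>a \<noteq> 0\<close> show False
    by simp
qed

end

section \<open>From the null lines of one fibre to the whole cone\<close>

context paraconformal_patch
begin

lemma E_k_eq': "q \<in> T1 \<Longrightarrow> \<exists>m. m \<noteq> 0 \<and> E k q = m *\<^sub>R rnc (\<pi> q) (\<sigma> q)"
  by (intro exI[of _ "vc 0 q"] conjI E_k_eq) (simp add: T1_def)

text \<open>Along an integral curve of X in the fibre a finite set of values would make the
  continuous function sigma constant on an interval, and the null line would stand still, contrary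
  to \<open>E_k_not_in_line\<close>. The same lemma rules out that the line stays at infinity, so
  sigma is defined somewhere on the curve.\<close>

lemma infinite_sigma:
  assumes y: "y \<in> W"
  shows "infinite {s. \<exists>p\<in>T1. \<pi> p = y \<and> \<sigma> p = s}" (is "infinite ?Z")
proof
  assume fin: "finite ?Z"
  obtain e c where e: "e > 0"
    and c: "\<And>t. t \<in> {-e<..<e} \<Longrightarrow> c t \<in> U \<and> \<pi> (c t) = y \<and> (c has_vector_derivative X (c t)) (at t)"
    using fibre_curve y W(2) by blast
  let ?I = "{-e<..<e}"
  have cT0: "c t \<in> T0" if "t \<in> ?I" for t
    using c[OF that] y by (simp add: T0_def)
  have cont: "continuous_on ?I c"
    using c by (meson continuous_at_imp_continuous_on has_vector_derivative_continuous)
  have "\<exists>t\<in>?I. c t \<in> T1"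
  proof (rule ccontr)
    assume none: "\<not> (\<exists>t\<in>?I. c t \<in> T1)"
    have "E k (c t) \<in> span {V k y}" if t: "t \<in> ?I" for t
    proof -
      have z: "coord (\<lambda>i. V i y) (E k (c t)) 0 = 0"
        using none t cT0[OF t] c[OF t] by (auto simp: T1_def)
      have "E k (c t) \<in> rnc_cone k (\<lambda>i. V i y)"
        using E_k_in_cone[OF cT0[OF t]] c[OF t] by simp
      then consider b s where "E k (c t) = b *\<^sub>R rnc y s" | b where "E k (c t) = b *\<^sub>R V k y"
        by (auto simp: rnc_cone_def)
      then show ?thesis
      proof cases
        \<comment> \<open>A finite point of the cone has V_0-coordinate b, so outside
          \<open>T1\<close> only b = 0 is possible.\<close>
        case 1
        then have "b = 0"
          using z by (simp add: coord_simps coord_rnc_point[OF frame_V[OF y]])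
        then show ?thesis
          using 1 by (simp add: span_zero)
      next
        case 2
        then show ?thesis
          by (auto simp: span_singleton)
      qed
    qed
    then show False
      using E_k_not_in_line[of ?I 0 c "V k y"] c e by auto
  qed
  then obtain t1 where t1: "t1 \<in> ?I" "c t1 \<in> T1"
    by blast
  \<comment> \<open>Shrink to an interval around t1 that stays in \<open>T1\<close>; its
    connectedness makes finitely many values of sigma collapse to one.\<close>
  have "open (?I \<inter> c -` T1)"
    by (rule continuous_open_preimage[OF cont open_greaterThanLessThan open_T1])
  then obtain dl where dl: "dl > 0" "ball t1 dl \<subseteq> ?I \<inter> c -` T1"
    using t1 open_contains_ball by blast
  let ?J = "ball t1 dl"
  have cont': "continuous_on ?J (\<lambda>t. \<sigma> (c t))"
    by (rule continuous_on_compose2[OF smooth_on_continuous[OF smooth_sigma] continuous_on_subset[OF cont]])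
      (use dl in auto)
  have "(\<lambda>t. \<sigma> (c t)) ` ?J \<subseteq> ?Z"
    using dl(2) c by blast
  then have fin': "finite ((\<lambda>t. \<sigma> (c t)) ` ?J)"
    by (rule finite_subset[OF _ fin])
  have "\<exists>s. \<forall>t\<in>?J. \<sigma> (c t) = s"
    using continuous_finite_range_constant[OF connected_ball cont' fin'] by (simp only: constant_on_def)
  then obtain s where s: "\<And>t. t \<in> ?J \<Longrightarrow> \<sigma> (c t) = s"
    by blast
  have "E k (c t) \<in> span {rnc y s}" if "t \<in> ?J" for t
  proof -
    have ct: "c t \<in> T1" "\<pi> (c t) = y"
      using that dl(2) c by auto
    obtain m where "E k (c t) = m *\<^sub>R rnc (\<pi> (c t)) (\<sigma> (c t))"
      using E_k_eq'[OF ct(1)] by blast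
    then show ?thesis
      by (auto simp: ct(2) s[OF that] span_singleton)
  qed
  moreover have "c t \<in> U \<and> (c has_vector_derivative X (c t)) (at t)" if "t \<in> ?J" for t
    using c[of t] that dl(2) by blast
  moreover have "open ?J" "t1 \<in> ?J"
    using dl(1) by auto
  ultimately show False
    using E_k_not_in_line[of ?J t1 c "rnc y s"] by blast
qed

text \<open>Ric(V(s), V(s)) is a polynomial in s of degree at most 2k with infinitely many zeros,
  hence the zero polynomial. Its coefficient at degree 2k is Ric(V_k, V_k), which settles the line
  at s = infinity, not reached by any value of s.\<close>

theorem ricci_null:
  assumes tg: "totally_geodesic_connection ix k U \<pi> M \<Gamma>" and y: "y \<in> W"
    and v: "v \<in> rnc_cone k (\<lambda>i. V i y)"
  shows "ricci \<Gamma> y v v = 0"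
proof -
  have yM: "y \<in> M"
    using y W by auto
  define q where "q = (\<Sum>i\<le>k. \<Sum>j\<le>k. monom (ricci \<Gamma> y (V j y) (V i y)) (i + j))"
  have q: "poly q s = ricci \<Gamma> y (rnc y s) (rnc y s)" for s
    unfolding rnc_point_def q_def
    by (simp add: linear_sum[OF linear_ricci(1)[OF yM]] linear_sum[OF linear_ricci(2)[OF yM]]
        linear_scale[OF linear_ricci(1)[OF yM]] linear_scale[OF linear_ricci(2)[OF yM]]
        poly_sum poly_monom power_add sum_distrib_left mult_ac)
  have "poly q s = 0" if s: "s \<in> {s. \<exists>p\<in>T1. \<pi> p = y \<and> \<sigma> p = s}" for s
  proof -
    obtain p where p: "p \<in> T1" "\<pi> p = y" "\<sigma> p = s"
      using s by blast
    have "ricci \<Gamma> (\<pi> p) (E k p) (E k p) = 0"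
      by (rule ricci_E_k[OF open_T1 T1_subset(2) eps_nabla_E_k totally_geodesic_eps[OF tg] p(1)])
        (use T1_subset(2) in auto)
    moreover obtain m where "m \<noteq> 0" "E k p = m *\<^sub>R rnc y s"
      using E_k_eq'[OF p(1)] p(2,3) by blast
    ultimately show ?thesis
      unfolding q using p(2) by (simp add: ricci_scaleR[OF yM])
  qed
  then have "{s. \<exists>p\<in>T1. \<pi> p = y \<and> \<sigma> p = s} \<subseteq> {s. poly q s = 0}"
    by blast
  then have "infinite {s. poly q s = 0}"
    by (rule infinite_super[OF _ infinite_sigma[OF y]])
  then have q0: "q = 0"
    using poly_roots_finite[of q] by (cases "q = 0") simp_all
  \<comment> \<open>For i, j <= k the sum i + j equals 2k only when i = j = k.\<close>
  have "coeff q (k + k) = (\<Sum>i\<le>k. \<Sum>j\<le>k. if j = k \<and> i = k then ricci \<Gamma> y (V j y) (V i y) else 0)"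
    unfolding q_def coeff_sum coeff_monom by (intro sum.cong refl) auto
  also have "\<dots> = (\<Sum>i\<le>k. if i = k then ricci \<Gamma> y (V k y) (V i y) else 0)"
    by (intro sum.cong refl) auto
  also have "\<dots> = ricci \<Gamma> y (V k y) (V k y)"
    by simp
  finally have "ricci \<Gamma> y (V k y) (V k y) = 0"
    using q0 by simp
  moreover have "ricci \<Gamma> y (rnc y s) (rnc y s) = 0" for s
    using q q0 by simp
  ultimately show ?thesis
    using v by (auto simp: rnc_cone_def ricci_scaleR[OF yM])
qed

end

theorem mainTheorem8:
  fixes k :: nat
    and ix :: "nat \<Rightarrow> 'n::finite"
    and F :: "'n jet \<Rightarrow> real"
    and U :: "('n jet) set"
    and \<pi> :: "'n jet \<Rightarrow> real ^ 'n"
    and M :: "(real ^ 'n) set"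
    and \<Gamma> :: "real ^ 'n \<Rightarrow> real ^ 'n \<Rightarrow> real ^ 'n \<Rightarrow> real ^ 'n"
  assumes "k \<ge> 2"
    and "solution_space ix k F U \<pi> M"
    and "wuenschmann_invariants_vanish ix k F U"
    and "is_connection M \<Gamma>"
    and "paraconformal_connection ix k U \<pi> M \<Gamma>"
    and "totally_geodesic_connection ix k U \<pi> M \<Gamma>"
  shows "(\<forall>y\<in>M. \<forall>v\<in>null_cone ix k U \<pi> y. ricci \<Gamma> y v v = 0) \<and>
    annihilating_section M (null_cone ix k U \<pi>) (ricci_sym \<Gamma>)"
proof -
  interpret jet_connection ix k F U \<pi> M \<Gamma>
    by unfold_locales (use assms in \<open>auto simp: solution_space_def\<close>)
  have null: "ricci \<Gamma> y v v = 0" if y: "y \<in> M" and v: "v \<in> null_cone ix k U \<pi> y" for y v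
  proof -
    \<comment> \<open>A frame adapted to the cones is given only near each point, so the patch is
      chosen anew for every y.\<close>
    obtain W V where patch: "open W" "y \<in> W" "W \<subseteq> M" "paraconformal_frame ix k U \<pi> W V"
      and cov: "\<And>Y s z. smooth_on W Y \<Longrightarrow> z \<in> W \<Longrightarrow> cov_deriv \<Gamma> Y (\<lambda>z. rnc_point k (\<lambda>i. V i z) s) z \<in>
              span {rnc_point k (\<lambda>i. V i z) s, vector_derivative (rnc_point k (\<lambda>i. V i z)) (at s)}"
      using assms(5) y unfolding paraconformal_connection_def by metis
    interpret paraconformal_patch ix k F U \<pi> M \<Gamma> W V
      by unfold_locales (fact patch cov)+
    have "v \<in> rnc_cone k (\<lambda>i. V i y)"
      using v patch(2,4) by (simp add: paraconformal_frame_def)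
    then show ?thesis
      by (rule ricci_null[OF assms(6) patch(2)])
  qed
  have "smooth_on M (\<lambda>y. (1 / 2) *\<^sub>R (ricci \<Gamma> y v w + ricci \<Gamma> y w v))" for v w
    by (intro smooth_on_scaleR[OF open_M] smooth_on_const smooth_on_add[OF open_M] smooth_ricci)
  then have "smooth_on M (\<lambda>y. ricci_sym \<Gamma> y v w)" for v w
    by (simp add: ricci_sym_def)
  moreover have "bilinear (ricci_sym \<Gamma> y)" if "y \<in> M" for y
    unfolding bilinear_def ricci_sym_def
    by (intro conjI allI linearI; simp add: linear_add[OF linear_ricci(1)[OF that]] linear_add[OF linear_ricci(2)[OF that]]
        linear_scale[OF linear_ricci(1)[OF that]] linear_scale[OF linear_ricci(2)[OF that]] algebra_simps add_divide_distrib)+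
  moreover have "ricci_sym \<Gamma> y v w = ricci_sym \<Gamma> y w v" for y v w
    by (simp add: ricci_sym_def)
  moreover have "ricci_sym \<Gamma> y v v = ricci \<Gamma> y v v" for y v
    by (simp add: ricci_sym_def)
  ultimately show ?thesis
    using null by (auto simp: annihilating_section_def)
qed

end
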